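(* Every Banach space with a $\mathcal{D}$-unconditional spreading Schauder basis satisfying $\mathcal{D}<\sqrt{6}-1$ has the weak fixed point property.
   Context: A Schauder basis $(e_n)$ of $X$ is $\mathcal{D}$-unconditional if it is unconditional (every expansion $x=\sum_na_ne_n$ converges unconditionally) and $\big\|\sum_n\epsilon_na_ne_n\big\|\le\mathcal{D}\big\|\sum_na_ne_n\big\|$ for every $x=\sum_na_ne_n\in X$ and every choice of signs $(\epsilon_n)\in\{-1,1\}^{\mathbb{N}}$. A basis $(e_n)$ is spreading if it is $1$-equivalent to all of its subsequences, i.e. $\big\|\sum_{i=1}^ka_ie_{n_i}\big\|=\big\|\sum_{i=1}^ka_ie_i\big\|$ for all $k\in\mathbb{N}$, all scalars $a_1,\dots,a_k$ and all $n_1<\dots<n_k$ in $\mathbb{N}$. A mapping $T\colon C\to C$ on a subset $C$ of $X$ is nonexpansive if $\|Tx-Ty\|\le\|x-y\|$ for all $x,y\in C$. A Banach space $X$ has the weak fixed point property if for every nonempty weakly compact convex subset $C$ of $X$, every nonexpansive mapping $T\colon C\to C$ has a fixed point. *)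

theory Defs
  imports "HOL-Analysis.Analysis"
begin

definition schauder_basis :: "(nat \<Rightarrow> 'a::banach) \<Rightarrow> bool" where
  "schauder_basis e \<longleftrightarrow> (\<forall>x. \<exists>!a :: nat \<Rightarrow> real. (\<lambda>n. a n *\<^sub>R e n) sums x)"

text \<open>
  The ordered limit of partial sums is \<open>sums\<close>; unconditional convergence is \<open>has_sum\<close>,
  the limit over the net of finite index sets, which in a Banach space agrees with convergence
  under every rearrangement.
\<close>

definition unconditional_basis :: "(nat \<Rightarrow> 'a::banach) \<Rightarrow> bool" where
  "unconditional_basis e \<longleftrightarrow>
     schauder_basis e \<and>
     (\<forall>x. \<forall>a :: nat \<Rightarrow> real.
        (\<lambda>n. a n *\<^sub>R e n) sums x \<longrightarrow> ((\<lambda>n. a n *\<^sub>R e n) has_sum x) UNIV)"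

text \<open>
  The signed series below converges by unconditionality, so its \<open>suminf\<close> is a genuine sum.
\<close>

definition D_unconditional_basis :: "real \<Rightarrow> (nat \<Rightarrow> 'a::banach) \<Rightarrow> bool" where
  "D_unconditional_basis D e \<longleftrightarrow>
     unconditional_basis e \<and>
     (\<forall>x. \<forall>a :: nat \<Rightarrow> real. \<forall>\<epsilon> :: nat \<Rightarrow> real.
        (\<lambda>n. a n *\<^sub>R e n) sums x \<longrightarrow> (\<forall>n. \<epsilon> n \<in> {-1, 1}) \<longrightarrow>
        norm (\<Sum>n. (\<epsilon> n * a n) *\<^sub>R e n) \<le> D * norm x)"

definition spreading :: "(nat \<Rightarrow> 'a::banach) \<Rightarrow> bool" where
  "spreading e \<longleftrightarrow>
     (\<forall>k. \<forall>a :: nat \<Rightarrow> real. \<forall>n :: nat \<Rightarrow> nat. strict_mono_on {..<k} n \<longrightarrow>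
        norm (\<Sum>i<k. a i *\<^sub>R e (n i)) = norm (\<Sum>i<k. a i *\<^sub>R e i))"

definition weak_topology :: "'a::real_normed_vector topology" where
  "weak_topology =
     topology_generated_by {f -` U | (f :: 'a \<Rightarrow> real) U. bounded_linear f \<and> open U}"

text \<open>The property of the whole space \<open>'a\<close>, written \<open>weak_fixed_point_property TYPE('a)\<close>.\<close>

definition weak_fixed_point_property :: "'a::banach itself \<Rightarrow> bool" where
  "weak_fixed_point_property (_ :: 'a itself) \<longleftrightarrow>
     (\<forall>C :: 'a set. C \<noteq> {} \<and> compactin weak_topology C \<and> convex C \<longrightarrow>
        (\<forall>T :: 'a \<Rightarrow> 'a. T \<in> C \<rightarrow> C \<and> 1-lipschitz_on C T \<longrightarrow> (\<exists>x\<in>C. T x = x)))"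

end

theory Submission
  imports Defs
begin

text \<open>
  The averages \<open>(e\<^sub>0 + \<dots> + e\<^sub>N\<^sub>-\<^sub>1) / N\<close> of the basis decide between two situations.

  If these averages can be made arbitrarily small in norm, then deleting coordinates does not increase
  the norm: because the basis is spreading, a single coordinate can be smeared out over many later
  positions without changing the norm of the vector, and averaging the smeared copies makes it
  disappear (\<open>spreading_suppression\<close>).  All coordinate projections and their complements are then
  contractions, and an argument of Lin for unconditional bases applies.  Let \<open>K\<close> be a minimal
  closed convex invariant set of a fixed point free nonexpansive map \<open>T\<close>, of diameter \<open>d > 0\<close>,
  and translate so that \<open>0 \<in> K\<close> is a weak cluster point of approximate fixed points.  Choose
  approximate fixed points \<open>u\<close> and \<open>v\<close> that are essentially supported on far away disjoint blocks,
  with midpoint \<open>z\<close>, and compare the fixed points \<open>w\<close> of \<open>(1 - l) T + l z\<close> and \<open>y\<close> of \<open>(1 - l) T\<close>.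
  Nonexpansiveness gives \<open>\<parallel>w - u\<parallel>, \<parallel>w - v\<parallel> \<le> d / 2\<close> up to a small error and
  \<open>\<parallel>w - y\<parallel> \<le> \<parallel>z\<parallel>\<close>, which is at most about \<open>D d / 2\<close> because \<open>u + v\<close> arises from \<open>u - v\<close> by a change
  of signs.  With the projections \<open>P\<close> and \<open>Q\<close> onto the two blocks,
  \<open>2 w = (w - P w) + (w - Q w) + (P + Q) w\<close>; the three terms hardly see \<open>u\<close>, \<open>v\<close> and \<open>y\<close>
  respectively, so \<open>\<parallel>w\<parallel>\<close> is at most about \<open>(1/2 + D/4) d\<close>, which is less than \<open>d\<close> since
  \<open>D < \<surd>6 - 1 < 2\<close>.  As \<open>l\<close> tends to \<open>0\<close> the points \<open>w\<close> become approximate fixed points.  This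
  contradicts the theorem of Goebel and Karlovitz that approximate fixed points in a minimal set are
  asymptotically at distance \<open>d\<close> from every point of it (\<open>minimal_invariant_diameter\<close>).  Lin works in
  an ultrapower; the damped maps make that passage unnecessary.

  If the averages stay away from \<open>0\<close>, then averaging the shifts of a finite combination shows that the
  sum of its coefficients is bounded by its norm (\<open>spreading_sum_functional\<close>), and unconditionality
  turns the basis into a copy of that of \<open>\<ell>\<^sub>1\<close>.  Approximate fixed points that cluster weakly at a
  point that is not fixed stay away from it in norm; a gliding hump argument, as in the proof of the
  Schur property, then produces a functional contradicting the weak convergence.

  Weak compactness enters through three facts resting on a Hahn-Banach separation theorem: closed convex
  sets are weakly closed, weakly compact sets are bounded, and a weakly compact set has the finite
  intersection property for closed convex sets.
\<close>

section \<open>Separation by continuous functionals and the weak topology\<close>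

definition sublinear :: "('a::real_vector \<Rightarrow> real) \<Rightarrow> bool" where
  "sublinear q \<longleftrightarrow> (\<forall>x y. q (x + y) \<le> q x + q y) \<and> (\<forall>t x. 0 \<le> t \<longrightarrow> q (t *\<^sub>R x) \<le> t * q x)"

lemma sublinear_zero:
  assumes "sublinear q" shows "q 0 = 0"
proof -
  have "q (0 *\<^sub>R 0) \<le> 0 * q 0" "q (0 + 0) \<le> q 0 + q 0"
    using assms unfolding sublinear_def by blast+
  then show ?thesis by simp
qed

lemma sublinear_scaleR:
  assumes "sublinear q" "0 \<le> t" shows "q (t *\<^sub>R x) = t * q x"
proof (cases "t = 0")
  case True then show ?thesis using sublinear_zero[OF assms(1)] by simp
next
  case False
  then have t: "t > 0" using assms(2) by simp
  have "q (inverse t *\<^sub>R (t *\<^sub>R x)) \<le> inverse t * q (t *\<^sub>R x)"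
    using assms(1) t unfolding sublinear_def by (simp del: scaleR_scaleR)
  then have "t * q x \<le> q (t *\<^sub>R x)" using t by (simp add: field_simps)
  moreover have "q (t *\<^sub>R x) \<le> t * q x" using assms unfolding sublinear_def by blast
  ultimately show ?thesis by simp
qed

lemma sublinear_lower_bound:
  assumes "sublinear q" "sublinear p" "q \<le> p" shows "- p (- x) \<le> q x"
proof -
  have "q (x + - x) \<le> q x + q (- x)" using assms(1) unfolding sublinear_def by blast
  then show ?thesis using sublinear_zero[OF assms(1)] le_funD[OF assms(3), of "- x"] by simp
qed

text \<open>
  Lower bounds for chains, as Zorn's lemma needs them.  The chain condition gives subadditivity: for
  two members the smaller one serves in both summands.
\<close>

lemma sublinear_INF:
  fixes p :: "'a::real_vector \<Rightarrow> real"
  assumes ne: "C \<noteq> {}" and sub: "\<And>q. q \<in> C \<Longrightarrow> sublinear q" and p: "sublinear p"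
    and le: "\<And>q. q \<in> C \<Longrightarrow> q \<le> p"
    and chain: "\<And>q r. q \<in> C \<Longrightarrow> r \<in> C \<Longrightarrow> q \<le> r \<or> r \<le> q"
  shows "sublinear (\<lambda>x. INF q\<in>C. q x)"
    and "\<And>q. q \<in> C \<Longrightarrow> (\<lambda>x. INF q\<in>C. q x) \<le> q"
proof -
  let ?u = "\<lambda>x. INF q\<in>C. q x"
  have u: "?u x \<le> q x" if "q \<in> C" for q x
    by (rule cINF_lower[OF _ that])
      (auto intro!: bdd_belowI[of _ "- p (- x)"] sublinear_lower_bound[OF sub p le])
  then show "\<And>q. q \<in> C \<Longrightarrow> ?u \<le> q" by (simp add: le_fun_def)
  have add: "?u (x + y) \<le> ?u x + ?u y" for x y
  proof -
    have *: "?u (x + y) \<le> q x + r y" if qr: "q \<in> C" "r \<in> C" for q r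
    proof -
      obtain s where s: "s \<in> C" "s \<le> q" "s \<le> r" using chain[OF qr] qr by blast
      have "?u (x + y) \<le> s (x + y)" by (rule u[OF s(1)])
      also have "\<dots> \<le> s x + s y" using sub[OF s(1)] unfolding sublinear_def by blast
      also have "\<dots> \<le> q x + r y" using s by (simp add: add_mono le_funD)
      finally show ?thesis .
    qed
    have "?u (x + y) - q x \<le> ?u y" if "q \<in> C" for q
      by (rule cINF_greatest[OF ne]) (use *[OF that] in \<open>simp add: algebra_simps\<close>)
    then have "?u (x + y) - ?u y \<le> ?u x"
      by (intro cINF_greatest[OF ne]) (simp add: algebra_simps)
    then show ?thesis by simp
  qed
  have scale: "?u (t *\<^sub>R x) \<le> t * ?u x" if "0 \<le> t" for t x
  proof (cases "t = 0")
    case True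
    obtain q where q: "q \<in> C" using ne by blast
    show ?thesis using u[OF q, of 0] sublinear_zero[OF sub[OF q]] True by simp
  next
    case False
    then have t: "t > 0" using that by simp
    have "?u (t *\<^sub>R x) / t \<le> ?u x"
      using u sublinear_scaleR[OF sub that] t
      by (intro cINF_greatest[OF ne]) (metis pos_divide_le_eq mult.commute)
    then show ?thesis using t by (simp add: field_simps)
  qed
  show "sublinear ?u" unfolding sublinear_def using add scale by blast
qed

text \<open>
  Descending from \<open>m\<close> along the ray in direction \<open>y\<close> yields a smaller sublinear functional; if \<open>m\<close>
  equals it, the displayed inequality says that \<open>m\<close> is superadditive in direction \<open>y\<close>.
\<close>

lemma sublinear_descent:
  assumes m: "sublinear m"
  shows "\<exists>q. sublinear q \<and> q \<le> m \<and> (\<forall>x. q x \<le> m (x + y) - m y)"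
proof -
  let ?F = "\<lambda>x t. m (x + t *\<^sub>R y) - t * m y"
  let ?q = "\<lambda>x. INF t\<in>{0..}. ?F x t"
  have add: "m (a + b) \<le> m a + m b" for a b using m unfolding sublinear_def by blast
  have low: "- m (- x) \<le> ?F x t" if "0 \<le> t" for x t
    using add[of "x + t *\<^sub>R y" "- x"] sublinear_scaleR[OF m that, of y] by simp
  have q: "?q x \<le> ?F x t" if "0 \<le> t" for x t
    by (rule cINF_lower) (use low that in \<open>auto intro!: bdd_belowI[of _ "- m (- x)"]\<close>)
  have ne: "{0::real..} \<noteq> {}" by auto
  have 1: "?q (a + b) \<le> ?q a + ?q b" for a b
  proof -
    have *: "?q (a + b) \<le> ?F a t + ?F b s" if "0 \<le> t" "0 \<le> s" for t s
    proof -
      have "?q (a + b) \<le> ?F (a + b) (t + s)" using q that by simp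
      also have "\<dots> \<le> ?F a t + ?F b s"
        using add[of "a + t *\<^sub>R y" "b + s *\<^sub>R y"] by (simp add: algebra_simps)
      finally show ?thesis .
    qed
    have "?q (a + b) - ?F a t \<le> ?q b" if "0 \<le> t" for t
      by (rule cINF_greatest[OF ne]) (use *[OF that] in \<open>simp add: algebra_simps\<close>)
    then have "?q (a + b) - ?q b \<le> ?q a"
      by (intro cINF_greatest[OF ne]) (simp add: algebra_simps)
    then show ?thesis by simp
  qed
  have 2: "?q (c *\<^sub>R x) \<le> c * ?q x" if "0 \<le> c" for c x
  proof (cases "c = 0")
    case True
    show ?thesis using q[of 0 0] True sublinear_zero[OF m] by simp
  next
    case False
    then have c: "c > 0" using that by simp
    have "?q (c *\<^sub>R x) / c \<le> ?F x t" if t: "0 \<le> t" for t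
    proof -
      have "?q (c *\<^sub>R x) \<le> ?F (c *\<^sub>R x) (c * t)" using q c t by simp
      also have "\<dots> = c * ?F x t"
        using sublinear_scaleR[OF m, of c "x + t *\<^sub>R y"] c by (simp add: algebra_simps)
      finally show ?thesis using c by (simp add: field_simps)
    qed
    then have "?q (c *\<^sub>R x) / c \<le> ?q x" by (intro cINF_greatest[OF ne]) auto
    then show ?thesis using c by (simp add: field_simps)
  qed
  have "sublinear ?q" unfolding sublinear_def using 1 2 by blast
  moreover have "?q \<le> m" using q[of 0] by (simp add: le_fun_def)
  moreover have "?q x \<le> m (x + y) - m y" for x using q[of 1 x] by simp
  ultimately show ?thesis by blast
qed

text \<open>
  Hahn-Banach without extending functionals step by step: a sublinear functional that is minimal
  among those below \<open>p\<close> must already be linear, since otherwise \<open>sublinear_descent\<close> lowers it.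
\<close>

theorem sublinear_dominates_linear:
  fixes p :: "'a::real_vector \<Rightarrow> real"
  assumes p: "sublinear p"
  shows "\<exists>f. linear f \<and> (\<forall>x. f x \<le> p x)"
proof -
  let ?S = "{q. sublinear q \<and> q \<le> p}"
  let ?P = "\<lambda>q r :: 'a \<Rightarrow> real. r \<le> q"
  have po: "partial_order_on ?S (relation_of ?P ?S)"
    by (rule partial_order_on_relation_ofI) auto
  have "\<exists>m\<in>?S. \<forall>q\<in>?S. ?P m q \<longrightarrow> q = m"
  proof (rule predicate_Zorn[OF po])
    fix C assume C: "C \<in> Chains (relation_of ?P ?S)"
    then have CS: "C \<subseteq> ?S" by (rule Chains_relation_of)
    have ch: "q \<le> r \<or> r \<le> q" if "q \<in> C" "r \<in> C" for q r
      using C that by (auto simp: Chains_def relation_of_def)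
    show "\<exists>u\<in>?S. \<forall>q\<in>C. ?P q u"
    proof (cases "C = {}")
      case True then show ?thesis using p by auto
    next
      case False
      then obtain q where q: "q \<in> C" by blast
      have u: "sublinear (\<lambda>x. INF q\<in>C. q x)" "\<And>q. q \<in> C \<Longrightarrow> (\<lambda>x. INF q\<in>C. q x) \<le> q"
        using sublinear_INF[OF False _ p _ ch] CS by blast+
      moreover have "(\<lambda>x. INF q\<in>C. q x) \<le> p" using u(2)[OF q] q CS by (blast intro: order_trans)
      ultimately show ?thesis by blast
    qed
  qed
  then obtain m where m: "sublinear m" "m \<le> p"
    and min: "\<And>q. sublinear q \<Longrightarrow> q \<le> p \<Longrightarrow> q \<le> m \<Longrightarrow> q = m" by blast
  have ge: "m x + m y \<le> m (x + y)" for x y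
  proof -
    obtain q where q: "sublinear q" "q \<le> m" "\<And>x. q x \<le> m (x + y) - m y"
      using sublinear_descent[OF m(1)] by blast
    have "q = m" using min q(1,2) m(2) by (blast intro: order_trans)
    then show ?thesis using q(3)[of x] by simp
  qed
  have add: "m (x + y) = m x + m y" for x y
    using ge[of x y] m(1) unfolding sublinear_def by (simp add: order_antisym)
  have neg: "m (- x) = - m x" for x using add[of x "- x"] sublinear_zero[OF m(1)] by simp
  have scale: "m (c *\<^sub>R x) = c * m x" for c x
  proof (cases "0 \<le> c")
    case False
    then have "m ((- c) *\<^sub>R x) = (- c) * m x" by (intro sublinear_scaleR[OF m(1)]) simp
    then show ?thesis using neg[of "c *\<^sub>R x"] by simp
  qed (rule sublinear_scaleR[OF m(1)])
  have "linear m" by (rule linearI) (use add scale in auto)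
  then show ?thesis using m(2) by (auto simp: le_fun_def)
qed

text \<open>
  The sublinear functional \<open>p x = inf {\<parallel>x + t (a - x0)\<parallel> - t d | t \<ge> 0, a \<in> A}\<close> is below the norm
  and at most \<open>- d\<close> at every \<open>x0 - a\<close>, so a linear functional below \<open>p\<close> is a contraction that
  separates \<open>x0\<close> from \<open>A\<close> by \<open>d\<close>.  Convexity of \<open>A\<close> is what makes \<open>p\<close> subadditive.
\<close>

theorem separating_functional:
  fixes A :: "'a::real_normed_vector set"
  assumes conv: "convex A" and ne: "A \<noteq> {}" and dist: "\<And>a. a \<in> A \<Longrightarrow> d \<le> norm (a - x0)"
  shows "\<exists>f. bounded_linear f \<and> (\<forall>x. \<bar>f x\<bar> \<le> norm x) \<and> (\<forall>a\<in>A. f x0 + d \<le> f a)"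
proof -
  let ?F = "\<lambda>x (t, a). norm (x + t *\<^sub>R (a - x0)) - t * d"
  let ?I = "{0::real..} \<times> A"
  let ?p = "\<lambda>x. INF i\<in>?I. ?F x i"
  obtain a0 where a0: "a0 \<in> A" using ne by blast
  then have "(0, a0) \<in> ?I" by simp
  then have neI: "?I \<noteq> {}" by (metis empty_iff)
  have low: "- norm x \<le> ?F x i" if I: "i \<in> ?I" for x i
  proof -
    obtain t a where i: "i = (t, a)" "0 \<le> t" "a \<in> A" using I by auto
    have "t * d \<le> norm (t *\<^sub>R (a - x0))" using dist[OF i(3)] i(2) by (simp add: mult_left_mono)
    also have "\<dots> \<le> norm (x + t *\<^sub>R (a - x0)) + norm x"
      using norm_triangle_ineq4[of "x + t *\<^sub>R (a - x0)" x] by simp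
    finally show ?thesis using i(1) by simp
  qed
  have p: "?p x \<le> ?F x i" if "i \<in> ?I" for x i
    by (rule cINF_lower[OF _ that]) (use low in \<open>auto intro!: bdd_belowI[of _ "- norm x"]\<close>)
  have 1: "?p (x + y) \<le> ?p x + ?p y" for x y
  proof -
    have *: "?p (x + y) \<le> ?F x i + ?F y j" if ij: "i \<in> ?I" "j \<in> ?I" for i j
    proof -
      obtain t a s b where i: "i = (t, a)" "0 \<le> t" "a \<in> A" and j: "j = (s, b)" "0 \<le> s" "b \<in> A"
        using ij by auto
      obtain c where c: "c \<in> A" "(t + s) *\<^sub>R c = t *\<^sub>R a + s *\<^sub>R b"
      proof (cases "t + s = 0")
        case True
        then have "t = 0" "s = 0" using i j by auto
        then show ?thesis using that[OF a0] by simp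
      next
        case False
        then have ts: "t + s > 0" using i j by auto
        have "(t / (t + s)) *\<^sub>R a + (s / (t + s)) *\<^sub>R b \<in> A"
          using conv i j ts by (intro convexD) (auto simp: add_divide_distrib[symmetric])
        moreover have "(t + s) *\<^sub>R ((t / (t + s)) *\<^sub>R a + (s / (t + s)) *\<^sub>R b) = t *\<^sub>R a + s *\<^sub>R b"
          using ts by (simp add: scaleR_add_right)
        ultimately show ?thesis by (rule that)
      qed
      have "?p (x + y) \<le> ?F (x + y) (t + s, c)" using c i j by (intro p) auto
      also have "\<dots> = norm ((x + t *\<^sub>R (a - x0)) + (y + s *\<^sub>R (b - x0))) - (t + s) * d"
        using c(2) by (simp add: algebra_simps)
      also have "\<dots> \<le> ?F x i + ?F y j"
        using norm_triangle_ineq[of "x + t *\<^sub>R (a - x0)" "y + s *\<^sub>R (b - x0)"] i(1) j(1)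
        by (simp add: algebra_simps)
      finally show ?thesis .
    qed
    have "?p (x + y) - ?F x i \<le> ?p y" if "i \<in> ?I" for i
      by (rule cINF_greatest[OF neI]) (use *[OF that] in \<open>simp add: algebra_simps\<close>)
    then have "?p (x + y) - ?p y \<le> ?p x"
      by (intro cINF_greatest[OF neI]) (simp add: algebra_simps)
    then show ?thesis by simp
  qed
  have 2: "?p (c *\<^sub>R x) \<le> c * ?p x" if "0 \<le> c" for c x
  proof (cases "c = 0")
    case True
    show ?thesis using p[of "(0, a0)" 0] True a0 by simp
  next
    case False
    then have c: "c > 0" using that by simp
    have "?p (c *\<^sub>R x) / c \<le> ?F x i" if I: "i \<in> ?I" for i
    proof -
      obtain t a where i: "i = (t, a)" "0 \<le> t" "a \<in> A" using I by auto
      have "?p (c *\<^sub>R x) \<le> ?F (c *\<^sub>R x) (c * t, a)" using i c by (intro p) auto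
      also have "\<dots> = norm (c *\<^sub>R (x + t *\<^sub>R (a - x0))) - c * t * d"
        by (simp add: scaleR_add_right)
      also have "\<dots> = c * ?F x i"
        unfolding norm_scaleR using c i(1) by (simp add: right_diff_distrib)
      finally show ?thesis using c by (simp add: field_simps)
    qed
    then have "?p (c *\<^sub>R x) / c \<le> ?p x" by (intro cINF_greatest[OF neI]) auto
    then show ?thesis using c by (simp add: field_simps)
  qed
  have "sublinear ?p" unfolding sublinear_def using 1 2 by blast
  then obtain f where f: "linear f" "\<And>x. f x \<le> ?p x" using sublinear_dominates_linear by blast
  have le: "f x \<le> norm x" for x
    using f(2)[of x] p[of "(0, a0)" x] a0 by simp
  have neg: "f (- x) = - f x" for x using f(1) by (simp add: linear_neg)
  have abs: "\<bar>f x\<bar> \<le> norm x" for x using le[of x] le[of "- x"] neg[of x] by simp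
  have "bounded_linear f"
    using abs f(1) by (intro bounded_linear_intro[where K=1]) (auto simp: linear_add linear_scale)
  moreover have "f x0 + d \<le> f a" if "a \<in> A" for a
  proof -
    have "f (x0 - a) \<le> ?F (x0 - a) (1, a)"
      using f(2)[of "x0 - a"] p[of "(1, a)" "x0 - a"] that by simp
    then show ?thesis using f(1) by (simp add: linear_diff)
  qed
  ultimately show ?thesis using abs by blast
qed

lemma topspace_weak_topology [simp]: "topspace weak_topology = (UNIV :: 'a::real_normed_vector set)"
proof -
  have "(\<lambda>_. 0) -` (UNIV::real set) \<in> {f -` U | (f :: 'a \<Rightarrow> real) U. bounded_linear f \<and> open U}"
    using bounded_linear_zero by blast
  then show ?thesis unfolding weak_topology_def by auto
qed

lemma openin_weak_vimage:
  fixes f :: "'a::real_normed_vector \<Rightarrow> real"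
  assumes "bounded_linear f" "open U" shows "openin weak_topology (f -` U)"
  unfolding weak_topology_def using assms by (intro topology_generated_by_Basis) blast

lemma openin_weak_imp_open:
  fixes S :: "'a::real_normed_vector set"
  assumes "openin weak_topology S" shows "open S"
proof -
  have "generate_topology_on {f -` U | (f :: 'a \<Rightarrow> real) U. bounded_linear f \<and> open U} S"
    using assms unfolding weak_topology_def by (rule openin_topology_generated_by)
  then show ?thesis
  proof induction
    case (Basis s)
    then show ?case by (auto intro!: open_vimage linear_continuous_on)
  qed (auto intro: open_Union)
qed

lemma closedin_weak_imp_closed: "closedin weak_topology S \<Longrightarrow> closed S"
  using openin_weak_imp_open[of "- S"] by (simp add: closedin_def closed_def Compl_eq_Diff_UNIV)

text \<open>
  Mazur's theorem: a point outside has positive distance to the set and is separated from it by a weak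
  neighbourhood, namely a half-space.
\<close>

lemma closedin_weak_if_closed_convex:
  fixes A :: "'a::real_normed_vector set"
  assumes "closed A" "convex A" shows "closedin weak_topology A"
proof (cases "A = {}")
  case False
  have "\<exists>T. openin weak_topology T \<and> x \<in> T \<and> T \<subseteq> - A" if x: "x \<in> - A" for x
  proof -
    have "open (- A)" using assms(1) by blast
    then obtain d where d: "d > 0" "ball x d \<subseteq> - A" using x open_contains_ball by blast
    have "d \<le> norm (a - x)" if "a \<in> A" for a
    proof (rule ccontr)
      assume "\<not> d \<le> norm (a - x)"
      then have "a \<in> ball x d" by (simp add: dist_norm norm_minus_commute)
      then show False using that d(2) by blast
    qed
    then obtain f where f: "bounded_linear f" "\<forall>a\<in>A. f x + d \<le> f a"
      using separating_functional[OF assms(2) False] by blast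
    have "openin weak_topology (f -` {..<f x + d})"
      by (rule openin_weak_vimage[OF f(1)]) simp
    moreover have "f -` {..<f x + d} \<subseteq> - A" using f(2) by force
    ultimately show ?thesis using d(1) by (intro exI[of _ "f -` {..<f x + d}"]) auto
  qed
  then have "openin weak_topology (- A)" by (subst openin_subopen) blast
  then show ?thesis by (simp add: closedin_def Compl_eq_Diff_UNIV)
qed simp

lemma Hausdorff_weak_topology:
  "Hausdorff_space (weak_topology :: 'a::real_normed_vector topology)"
  unfolding Hausdorff_space_def
proof (intro allI impI)
  fix x y :: 'a assume "x \<in> topspace weak_topology \<and> y \<in> topspace weak_topology \<and> x \<noteq> y"
  then have d: "norm (y - x) > 0" by simp
  obtain f where f: "bounded_linear f" "f x + norm (y - x) \<le> f y"
    using separating_functional[of "{y}" "norm (y - x)" x] by auto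
  let ?m = "f x + norm (y - x) / 2"
  have "openin weak_topology (f -` {..<?m})" "openin weak_topology (f -` {?m<..})"
    using openin_weak_vimage[OF f(1)] by simp_all
  moreover have "f x < ?m" "?m < f y" using d f(2) by linarith+
  then have "x \<in> f -` {..<?m}" "y \<in> f -` {?m<..}" by auto
  moreover have "disjnt (f -` {..<?m}) (f -` {?m<..})" by (auto simp: disjnt_def)
  ultimately show "\<exists>U V. openin weak_topology U \<and> openin weak_topology V \<and> x \<in> U \<and> y \<in> V \<and> disjnt U V"
    by blast
qed

lemma weakly_compact_imp_closed:
  "compactin weak_topology C \<Longrightarrow> closed C"
  using compactin_imp_closedin[OF Hausdorff_weak_topology] closedin_weak_imp_closed by blast

text \<open>
  Uniform boundedness by the Baire category theorem in the dual space: every functional is bounded on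
  \<open>C\<close>, so the functionals bounded by some fixed \<open>n\<close> contain a ball, and functionals that norm the
  points of \<open>C\<close> can be scaled into that ball.
\<close>

lemma weakly_compact_imp_bounded:
  fixes C :: "'a::real_normed_vector set"
  assumes C: "compactin weak_topology C"
  shows "bounded C"
proof -
  let ?F = "\<lambda>n::nat. {f :: 'a \<Rightarrow>\<^sub>L real. \<forall>x\<in>C. \<bar>blinfun_apply f x\<bar> \<le> real n}"
  have closed: "closed (?F n)" for n
  proof -
    have "?F n = (\<Inter>x\<in>C. {f. \<bar>blinfun_apply f x\<bar> \<le> real n})" by auto
    moreover have "closed {f :: 'a \<Rightarrow>\<^sub>L real. \<bar>blinfun_apply f x\<bar> \<le> real n}" for x
      by (intro closed_Collect_le continuous_intros)
    ultimately show ?thesis by auto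
  qed
  have cover: "(\<Union>n. ?F n) = UNIV"
  proof -
    have "\<exists>n. f \<in> ?F n" for f :: "'a \<Rightarrow>\<^sub>L real"
    proof -
      have "continuous_map weak_topology euclideanreal (blinfun_apply f)"
        unfolding continuous_map_alt
        using openin_weak_vimage[OF blinfun.bounded_linear_right, of _ f] by simp
      then have "compact (blinfun_apply f ` C)" using image_compactin[OF C] by force
      then obtain b where b: "\<And>x. x \<in> C \<Longrightarrow> \<bar>blinfun_apply f x\<bar> \<le> b"
        by (meson bounded_real compact_imp_bounded imageI)
      obtain n :: nat where "b \<le> real n" using real_arch_simple by blast
      then show ?thesis using b by (intro exI[of _ n]) force
    qed
    then show ?thesis by blast
  qed
  have "\<exists>n. interior (?F n) \<noteq> {}"
  proof (rule ccontr)
    assume "\<not> ?thesis"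
    then have "euclidean interior_of (\<Union>(range ?F)) = {}"
      using closed completely_metrizable_space_euclidean
      by (intro Baire_category_alt) (auto)
    then show False using cover by simp
  qed
  then obtain n f0 where "f0 \<in> interior (?F n)" by blast
  then obtain r where r: "r > 0" "cball f0 r \<subseteq> ?F n" using mem_interior_cball by blast
  have "norm x \<le> 2 * real n / r" if x: "x \<in> C" for x
  proof -
    obtain f where f: "bounded_linear f" "\<And>y. \<bar>f y\<bar> \<le> norm y" "f 0 + norm x \<le> f x"
      using separating_functional[of "{x}" "norm x" 0] by auto
    let ?g = "Blinfun f"
    have g: "blinfun_apply ?g = f" using f(1) by (rule bounded_linear_Blinfun_apply)
    have "norm ?g \<le> 1" using f(2) g by (intro norm_blinfun_bound) auto
    then have "f0 + r *\<^sub>R ?g \<in> cball f0 r" using r(1) by (simp add: dist_norm mult_left_le)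
    then have 1: "\<bar>blinfun_apply f0 x + r * f x\<bar> \<le> real n"
      using r(2) x g by (force simp: blinfun.add_left blinfun.scaleR_left)
    have "f0 \<in> cball f0 r" using r(1) by simp
    then have 2: "\<bar>blinfun_apply f0 x\<bar> \<le> real n" using r(2) x by force
    have "norm x \<le> f x" using f(3) linear_simps(3)[OF f(1)] by simp
    then have "r * norm x \<le> r * f x" using r(1) by simp
    also have "\<dots> \<le> 2 * real n" using 1 2 by linarith
    finally show ?thesis using r(1) by (simp add: field_simps)
  qed
  then show ?thesis unfolding bounded_iff by blast
qed

lemma weakly_compact_inter_nonempty:
  fixes C :: "'a::real_normed_vector set"
  assumes C: "compactin weak_topology C"
    and cl: "\<And>A. A \<in> \<U> \<Longrightarrow> closed A \<and> convex A"
    and fin: "\<And>\<F>. finite \<F> \<Longrightarrow> \<F> \<subseteq> \<U> \<Longrightarrow> C \<inter> \<Inter>\<F> \<noteq> {}"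
  shows "C \<inter> \<Inter>\<U> \<noteq> {}"
proof -
  have "\<forall>A\<in>\<U>. closedin weak_topology A" using cl closedin_weak_if_closed_convex by blast
  moreover have "\<forall>\<F>. finite \<F> \<and> \<F> \<subseteq> \<U> \<longrightarrow> C \<inter> \<Inter>\<F> \<noteq> {}" using fin by blast
  ultimately show ?thesis using C unfolding compactin_fip by blast
qed


section \<open>Minimal invariant sets of nonexpansive maps\<close>

definition invariant_convex :: "('a::real_normed_vector \<Rightarrow> 'a) \<Rightarrow> 'a set \<Rightarrow> bool" where
  "invariant_convex T K \<longleftrightarrow> K \<noteq> {} \<and> closed K \<and> convex K \<and> T \<in> K \<rightarrow> K"

definition minimal_invariant :: "('a::real_normed_vector \<Rightarrow> 'a) \<Rightarrow> 'a set \<Rightarrow> bool" where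
  "minimal_invariant T K \<longleftrightarrow>
     invariant_convex T K \<and> (\<forall>L\<subseteq>K. invariant_convex T L \<longrightarrow> L = K)"

lemma weakly_compact_closed_convex_subset:
  assumes "compactin weak_topology C" "K \<subseteq> C" "closed K" "convex K"
  shows "compactin weak_topology K"
  using closed_compactin[OF assms(1,2)] closedin_weak_if_closed_convex assms(3,4) by blast

text \<open>
  Zorn's lemma; the intersection of a chain is nonempty because its members are weakly closed
  subsets of a weakly compact set.
\<close>

lemma exists_minimal_invariant:
  assumes C: "compactin weak_topology C" "convex C" "C \<noteq> {}" and T: "T \<in> C \<rightarrow> C"
  shows "\<exists>K\<subseteq>C. minimal_invariant T K"
proof -
  let ?S = "{K. K \<subseteq> C \<and> invariant_convex T K}"
  let ?P = "\<lambda>K L :: 'a set. L \<subseteq> K"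
  have CS: "C \<in> ?S"
    using C T weakly_compact_imp_closed unfolding invariant_convex_def by blast
  have po: "partial_order_on ?S (relation_of ?P ?S)"
    by (rule partial_order_on_relation_ofI) auto
  have "\<exists>K\<in>?S. \<forall>L\<in>?S. ?P K L \<longrightarrow> L = K"
  proof (rule predicate_Zorn[OF po])
    fix \<C> assume ch: "\<C> \<in> Chains (relation_of ?P ?S)"
    then have sub: "\<C> \<subseteq> ?S" by (rule Chains_relation_of)
    have total: "K \<subseteq> L \<or> L \<subseteq> K" if "K \<in> \<C>" "L \<in> \<C>" for K L
      using ch that by (auto simp: Chains_def relation_of_def)
    show "\<exists>U\<in>?S. \<forall>K\<in>\<C>. ?P K U"
    proof (cases "\<C> = {}")
      case True then show ?thesis using CS by blast
    next
      case False
      then obtain K0 where K0: "K0 \<in> \<C>" by blast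
      have "C \<inter> \<Inter>\<C> \<noteq> {}"
      proof (rule weakly_compact_inter_nonempty[OF C(1)])
        show "closed A \<and> convex A" if "A \<in> \<C>" for A
          using that sub unfolding invariant_convex_def by blast
        show "C \<inter> \<Inter>\<F> \<noteq> {}" if F: "finite \<F>" "\<F> \<subseteq> \<C>" for \<F>
        proof -
          have "\<exists>L\<in>\<C>. L \<subseteq> \<Inter>\<F>" using F
          proof (induction rule: finite_induct)
            case empty then show ?case using K0 by blast
          next
            case (insert A \<F>)
            then obtain L where L: "L \<in> \<C>" "L \<subseteq> \<Inter>\<F>" by blast
            have "L \<subseteq> A \<or> A \<subseteq> L" using total L(1) insert.prems by blast
            then show ?case using L insert.prems by blast
          qed
          then obtain L where L: "L \<in> \<C>" "L \<subseteq> \<Inter>\<F>" by blast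
          have "L \<noteq> {}" "L \<subseteq> C" using L(1) sub unfolding invariant_convex_def by blast+
          then show ?thesis using L(2) by blast
        qed
      qed
      then have "\<Inter>\<C> \<noteq> {}" by blast
      moreover have "closed (\<Inter>\<C>)" "convex (\<Inter>\<C>)" "T \<in> \<Inter>\<C> \<rightarrow> \<Inter>\<C>"
        using sub unfolding invariant_convex_def
        by (auto intro!: closed_Inter convex_Inter)
      moreover have "\<Inter>\<C> \<subseteq> C" using K0 sub by blast
      ultimately show ?thesis unfolding invariant_convex_def by blast
    qed
  qed
  then obtain K where K: "K \<in> ?S" and min: "\<forall>L\<in>?S. L \<subseteq> K \<longrightarrow> L = K" by (elim bexE)
  have "L = K" if "L \<subseteq> K" "invariant_convex T L" for L using min K that by (simp add: subset_trans[of L K C])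
  then have "minimal_invariant T K" unfolding minimal_invariant_def using K by simp
  then show ?thesis using K by auto
qed

text \<open>
  Contracting towards \<open>z\<close> turns a nonexpansive map into a strict contraction, so Banach's theorem
  applies.  For small \<open>l\<close> these fixed points are approximate fixed points of \<open>T\<close>, and their position
  can be controlled through the choice of \<open>z\<close>.
\<close>

lemma damped_fixed_point:
  fixes K :: "'a::banach set"
  assumes K: "closed K" "convex K" "T \<in> K \<rightarrow> K" and T: "1-lipschitz_on K T"
    and z: "z \<in> K" and l: "0 < l" "l \<le> 1"
  shows "\<exists>w\<in>K. w = (1 - l) *\<^sub>R T w + l *\<^sub>R z"
proof -
  let ?f = "\<lambda>w. (1 - l) *\<^sub>R T w + l *\<^sub>R z"
  have "\<exists>!w\<in>K. ?f w = w"
  proof (rule Banach_fix[where c = "1 - l"])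
    show "complete K" using K(1) by (simp add: complete_eq_closed)
    show "?f ` K \<subseteq> K" using K z l by (auto intro!: convexD)
    show "dist (?f x) (?f y) \<le> (1 - l) * dist x y" if "x \<in> K" "y \<in> K" for x y
    proof -
      have "dist (?f x) (?f y) = (1 - l) * dist (T x) (T y)"
        using l by (simp add: dist_norm flip: scaleR_diff_right)
      then show ?thesis using lipschitz_onD[OF T that] l by (simp add: mult_left_mono)
    qed
  qed (use z l in auto)
  then show ?thesis by metis
qed

lemma damped_fixed_point_displacement:
  fixes w :: "'a::real_normed_vector"
  assumes w: "w = (1 - l) *\<^sub>R t + l *\<^sub>R z" and l: "0 \<le> l" and b: "norm (t - z) \<le> b"
  shows "norm (t - w) \<le> l * b"
proof -
  have "t - w = l *\<^sub>R (t - z)" using w by (simp add: algebra_simps)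
  then show ?thesis using l b by (simp add: mult_left_mono)
qed

lemma approximate_fixed_point:
  fixes K :: "'a::banach set"
  assumes K: "closed K" "convex K" "K \<noteq> {}" "T \<in> K \<rightarrow> K" "bounded K" and T: "1-lipschitz_on K T"
    and d: "0 < d"
  shows "\<exists>w\<in>K. norm (T w - w) \<le> d"
proof -
  obtain z where z: "z \<in> K" using K by blast
  obtain b where b: "b > 0" "\<And>x y. x \<in> K \<Longrightarrow> y \<in> K \<Longrightarrow> dist x y \<le> b"
    using K(5) unfolding bounded_two_points by (metis less_add_one max.strict_coboundedI2 max.cobounded1 order.trans zero_less_one)
  define l where "l = min 1 (d / b)"
  have l: "0 < l" "l \<le> 1" "l * b \<le> d" using b d by (auto simp: l_def min_def field_simps)
  obtain w where w: "w \<in> K" "w = (1 - l) *\<^sub>R T w + l *\<^sub>R z"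
    using damped_fixed_point[OF K(1,2,4) T z l(1,2)] by blast
  have "norm (T w - z) \<le> b" using b(2)[of "T w" z] w(1) z K(4) by (auto simp: dist_norm)
  then have "norm (T w - w) \<le> l * b"
    using damped_fixed_point_displacement[OF w(2)] l by simp
  then show ?thesis using l w by force
qed

text \<open>
  The lemma of Goebel and Karlovitz.  The points to which the given approximate fixed points \<open>w n\<close> come
  asymptotically within \<open>r\<close> form a closed convex invariant set containing \<open>x\<close>, hence all of \<open>K\<close>.
  By weak compactness some point of \<open>K\<close> then has all of \<open>K\<close> within \<open>r + e\<close>.  Such central points
  again form an invariant set: if \<open>v\<close> is central then \<open>T\<close> maps \<open>K\<close> into the ball of radius \<open>r + e\<close>
  around \<open>T v\<close>, and by minimality that ball contains \<open>K\<close>.  So every point is central.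
\<close>

lemma minimal_invariant_diameter:
  assumes K: "minimal_invariant T K" "compactin weak_topology K" and T: "1-lipschitz_on K T"
    and app: "\<And>d. d > 0 \<Longrightarrow> \<exists>w\<in>K. norm (T w - w) \<le> d \<and> norm (w - x) \<le> r"
    and x: "x \<in> K" and yz: "y \<in> K" "z \<in> K"
  shows "norm (y - z) \<le> r"
proof -
  have inv: "closed K" "convex K" and TK: "\<And>y. y \<in> K \<Longrightarrow> T y \<in> K"
    using K(1) unfolding minimal_invariant_def invariant_convex_def by auto
  have min: "L = K" if "L \<subseteq> K" "L \<noteq> {}" "closed L" "convex L" "\<And>y. y \<in> L \<Longrightarrow> T y \<in> L" for L
    using K(1) that unfolding minimal_invariant_def invariant_convex_def by blast
  have nonexp: "norm (T a - T b) \<le> norm (a - b)" if "a \<in> K" "b \<in> K" for a b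
    using lipschitz_onD[OF T that] by (simp add: dist_norm)
  have "\<exists>w\<in>K. norm (T w - w) \<le> 1 / Suc n \<and> norm (w - x) \<le> r" for n
    using app[of "1 / Suc n"] by simp
  then obtain w where w: "\<And>n. w n \<in> K" "\<And>n. norm (T (w n) - w n) \<le> 1 / Suc n"
      "\<And>n. norm (w n - x) \<le> r" by metis
  define L where "L = {y\<in>K. \<forall>e>0. \<forall>\<^sub>F n in sequentially. norm (w n - y) \<le> r + e}"
  have small: "\<forall>\<^sub>F n in sequentially. norm (T (w n) - w n) \<le> e" if "e > 0" for e
  proof -
    have "\<forall>\<^sub>F n in sequentially. 1 / Suc n < e"
      using order_tendstoD(2)[OF lim_1_over_n[THEN filterlim_sequentially_Suc[THEN iffD2]] that]
      by simp
    then show ?thesis by eventually_elim (use w(2) in \<open>meson less_imp_le order.trans\<close>)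
  qed
  have "L = K"
  proof (rule min)
    show "L \<subseteq> K" unfolding L_def by blast
    have "x \<in> L" using x w(3) unfolding L_def
      by (auto intro!: always_eventually) (meson add_increasing2 less_imp_le order.trans order_refl)
    then show "L \<noteq> {}" by blast
    show "closed L"
      unfolding closed_sequential_limits
    proof (intro allI impI, elim conjE)
      fix s l assume s: "\<forall>n. s n \<in> L" "s \<longlonglongrightarrow> l"
      have "l \<in> K" using closed_sequentially[OF inv(1)] s unfolding L_def by blast
      moreover have "\<forall>\<^sub>F n in sequentially. norm (w n - l) \<le> r + e" if e: "e > 0" for e
      proof -
        obtain k where k: "dist (s k) l < e / 2"
          using metric_LIMSEQ_D[OF s(2), of "e / 2"] e by auto
        have "\<forall>\<^sub>F n in sequentially. norm (w n - s k) \<le> r + e / 2"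
          using s(1) e unfolding L_def by simp
        then show ?thesis
        proof eventually_elim
          case (elim n)
          then show ?case
            using k norm_triangle_ineq[of "w n - s k" "s k - l"] by (simp add: dist_norm)
        qed
      qed
      ultimately show "l \<in> L" unfolding L_def by blast
    qed
    show "convex L"
    proof (rule convexI)
      fix a b and s t :: real assume ab: "a \<in> L" "b \<in> L" and st: "0 \<le> s" "0 \<le> t" "s + t = 1"
      have "\<forall>\<^sub>F n in sequentially. norm (w n - (s *\<^sub>R a + t *\<^sub>R b)) \<le> r + e" if e: "e > 0" for e
      proof -
        have "\<forall>\<^sub>F n in sequentially. norm (w n - a) \<le> r + e"
          "\<forall>\<^sub>F n in sequentially. norm (w n - b) \<le> r + e"
          using ab e unfolding L_def by auto
        then show ?thesis
        proof eventually_elim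
          case (elim n)
          have "s *\<^sub>R a + t *\<^sub>R b \<in> cball (w n) (r + e)"
            using elim st by (intro convexD[OF convex_cball]) (auto simp: dist_norm)
          then show ?case by (simp add: dist_norm)
        qed
      qed
      then show "s *\<^sub>R a + t *\<^sub>R b \<in> L" using ab st inv(2) unfolding L_def by (auto intro: convexD)
    qed
    fix y assume y: "y \<in> L"
    have yK: "y \<in> K" using y unfolding L_def by blast
    have "\<forall>\<^sub>F n in sequentially. norm (w n - T y) \<le> r + e" if e: "e > 0" for e
    proof -
      have "\<forall>\<^sub>F n in sequentially. norm (w n - y) \<le> r + e / 2"
        using y e unfolding L_def by simp
      moreover have "\<forall>\<^sub>F n in sequentially. norm (T (w n) - w n) \<le> e / 2" using small[of "e / 2"] e by simp
      ultimately show ?thesis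
      proof eventually_elim
        case (elim n)
        then show ?case
          using norm_triangle_ineq[of "w n - T (w n)" "T (w n) - T y"] nonexp[OF w(1) yK, of n]
          by (simp add: norm_minus_commute)
      qed
    qed
    then show "T y \<in> L" using TK[OF yK] unfolding L_def by blast
  qed
  have diam: "norm (y - z) \<le> r + e" if e: "e > 0" for e
  proof -
    let ?Z = "{v\<in>K. \<forall>y\<in>K. norm (v - y) \<le> r + e}"
    have Z: "?Z = K \<inter> (\<Inter>y\<in>K. cball y (r + e))"
      by (auto simp: dist_norm norm_minus_commute)
    have "?Z = K"
    proof (rule min)
      show "?Z \<subseteq> K" by blast
      show "closed ?Z" unfolding Z using inv(1) by (intro closed_Int closed_INT) auto
      show "convex ?Z" unfolding Z using inv(2) by (intro convex_Int convex_INT) auto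
      show "?Z \<noteq> {}" unfolding Z
      proof (rule weakly_compact_inter_nonempty[OF K(2)])
        fix \<F> assume "finite \<F>" "\<F> \<subseteq> (\<lambda>y. cball y (r + e)) ` K"
        then obtain F where F: "finite F" "F \<subseteq> K" "\<F> = (\<lambda>y. cball y (r + e)) ` F"
          using finite_subset_image by metis
        have "\<forall>\<^sub>F n in sequentially. \<forall>y\<in>F. norm (w n - y) \<le> r + e"
          using F(1,2) e \<open>L = K\<close> unfolding L_def by (intro eventually_ball_finite) blast+
        then obtain n where "\<forall>y\<in>F. norm (w n - y) \<le> r + e"
          using eventually_happens'[OF sequentially_bot] by blast
        then have "w n \<in> K \<inter> \<Inter>\<F>"
          using w(1) F(3) by (auto simp: dist_norm norm_minus_commute)
        then show "K \<inter> \<Inter>\<F> \<noteq> {}" by blast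
      qed auto
      fix v assume v: "v \<in> ?Z"
      let ?H = "K \<inter> cball (T v) (r + e)"
      have TH: "T y \<in> ?H" if "y \<in> K" for y
        using nonexp[of v y] v that TK by (force simp: dist_norm)
      have "?H = K"
      proof (rule min)
        show "closed ?H" "convex ?H" using inv by (auto intro: convex_Int)
        show "?H \<noteq> {}" using TH yz(1) by blast
      qed (use TH in auto)
      then have "K \<subseteq> cball (T v) (r + e)" by blast
      then show "T v \<in> ?Z" using v TK by (auto simp: dist_norm subset_iff)
    qed
    then show ?thesis using yz by blast
  qed
  show ?thesis by (rule field_le_epsilon) (rule diam)
qed

text \<open>
  This replaces the extraction of a weakly convergent sequence of approximate fixed points: by
  compactness the weak closures of the sets of \<open>d\<close>-approximate fixed points have a common point.
\<close>

lemma weak_cluster_approximate_fixed_points: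
  fixes K :: "'a::banach set"
  assumes K: "compactin weak_topology K" "convex K" "K \<noteq> {}" "T \<in> K \<rightarrow> K" and T: "1-lipschitz_on K T"
  shows "\<exists>x\<in>K. \<forall>d>0. \<forall>F. finite F \<and> (\<forall>f\<in>F. bounded_linear f) \<longrightarrow> (\<forall>e>0.
           \<exists>u\<in>K. norm (T u - u) \<le> d \<and> (\<forall>f\<in>F. \<bar>f (u - x) :: real\<bar> < e))"
proof -
  let ?A = "\<lambda>d. {u\<in>K. norm (T u - u) \<le> d}"
  let ?U = "(\<lambda>d. weak_topology closure_of ?A d) ` {0<..}"
  have "K \<inter> \<Inter>?U \<noteq> {}"
  proof -
    have "K \<inter> \<Inter>\<F> \<noteq> {}" if \<F>: "finite \<F>" "\<F> \<subseteq> ?U" for \<F>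
    proof -
      have "\<exists>D\<subseteq>{0<..}. finite D \<and> \<F> = (\<lambda>d. weak_topology closure_of ?A d) ` D"
        by (rule finite_subset_image[OF \<F>])
      then obtain D where D: "finite D" "D \<subseteq> {0<..}" "\<F> = (\<lambda>d. weak_topology closure_of ?A d) ` D"
        by (elim exE conjE)
      define d where "d = Min (insert 1 D)"
      have d: "d > 0" "\<And>d'. d' \<in> D \<Longrightarrow> d \<le> d'" using D(1,2) by (auto simp: d_def)
      obtain u where u: "u \<in> K" "norm (T u - u) \<le> d"
        using approximate_fixed_point[OF weakly_compact_imp_closed[OF K(1)] K(2-4)
            weakly_compact_imp_bounded[OF K(1)] T d(1)] by blast
      have "u \<in> weak_topology closure_of ?A d'" if "d' \<in> D" for d'
      proof -
        have "u \<in> ?A d'" using u d(2)[OF that] by simp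
        then show ?thesis using closure_of_subset[of "?A d'" weak_topology] by auto
      qed
      then have "u \<in> K \<inter> \<Inter>\<F>" using u(1) D(3) by simp
      then show ?thesis by blast
    qed
    then have "\<forall>\<F>. finite \<F> \<and> \<F> \<subseteq> ?U \<longrightarrow> K \<inter> \<Inter>\<F> \<noteq> {}" by blast
    moreover have "\<forall>A\<in>?U. closedin weak_topology A" by simp
    ultimately show ?thesis using K(1) unfolding compactin_fip by blast
  qed
  then obtain x where x: "x \<in> K" "\<And>d. d > 0 \<Longrightarrow> x \<in> weak_topology closure_of ?A d" by blast
  have "\<exists>u\<in>K. norm (T u - u) \<le> d \<and> (\<forall>f\<in>F. \<bar>f (u - x)\<bar> < e)"
    if d: "d > 0" and F: "finite F" "\<forall>f\<in>F. bounded_linear f" and e: "e > 0"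
    for d e and F :: "('a \<Rightarrow> real) set"
  proof -
    let ?N = "\<Inter>f\<in>F. f -` {f x - e<..<f x + e}"
    have "openin weak_topology ?N"
    proof (cases "F = {}")
      case True
      then show ?thesis using openin_topspace[of weak_topology] by simp
    next
      case False
      have "openin weak_topology (f -` {f x - e<..<f x + e})" if "f \<in> F" for f
        by (rule openin_weak_vimage) (use F(2) that in auto)
      then show ?thesis using F(1) False by (intro openin_INT2) auto
    qed
    moreover have "x \<in> ?N" using e by simp
    ultimately obtain u where u: "u \<in> ?A d" "u \<in> ?N"
      using x(2)[OF d] unfolding in_closure_of by blast
    have "\<bar>f (u - x)\<bar> < e" if "f \<in> F" for f
      using u(2) that linear_simps(2)[of f u x] F(2) by (auto simp: abs_less_iff)
    then show ?thesis using u(1) by blast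
  qed
  then show ?thesis using x(1) by blast
qed


section \<open>Spreading sequences\<close>

lemma sum_lessThan_add:
  fixes f :: "nat \<Rightarrow> 'a::comm_monoid_add"
  shows "(\<Sum>s<m + n. f s) = (\<Sum>s<m. f s) + (\<Sum>s<n. f (m + s))"
  by (induction n) (simp_all add: add.assoc)

lemma spreading_normD:
  assumes "spreading e" "strict_mono_on {..<k} n"
  shows "norm (\<Sum>i<k. a i *\<^sub>R e (n i)) = norm (\<Sum>i<k. a i *\<^sub>R e i)"
  using assms unfolding spreading_def by blast

lemma spreading_norm_eq:
  assumes "spreading e"
  shows "norm (e n) = norm (e 0)"
proof -
  have "strict_mono_on {..<1::nat} (\<lambda>_. n)" by (auto simp: strict_mono_on_def)
  from spreading_normD[OF assms this, of "\<lambda>_. 1"] show ?thesis by simp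
qed

lemma spreading_shift:
  assumes "spreading e"
  shows "norm (\<Sum>i<k. a i *\<^sub>R e (i + s)) = norm (\<Sum>i<k. a i *\<^sub>R e i)"
proof -
  have "strict_mono_on {..<k} (\<lambda>i. i + s)" by (simp add: strict_mono_on_def)
  from spreading_normD[OF assms this] show ?thesis .
qed

text \<open>
  Moving the \<open>j\<close>-th coordinate to position \<open>j + l\<close>, for \<open>l < N\<close>, and all later ones by \<open>N\<close> preserves
  the norm.  The mean over \<open>l\<close> of these vectors carries, in place of that coordinate, \<open>a j\<close> times an
  average of \<open>N\<close> basis vectors, which is negligible.
\<close>

lemma spreading_remove_coordinate:
  assumes sp: "spreading e" and j: "j < k"
    and avg: "\<And>r. r > 0 \<Longrightarrow> \<exists>N>0. norm (\<Sum>l<N. e l) \<le> r * real N"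
  shows "norm (\<Sum>i\<in>{..<k} - {j}. a i *\<^sub>R e i) \<le> norm (\<Sum>i<k. a i *\<^sub>R e i)"
proof (rule field_le_epsilon)
  fix d :: real assume d: "d > 0"
  define r where "r = d / (\<bar>a j\<bar> + 1)"
  have r: "r > 0" "\<bar>a j\<bar> * r \<le> d" using d by (auto simp: r_def field_simps)
  obtain N where N: "N > 0" "norm (\<Sum>l<N. e l) \<le> r * real N" using avg[OF r(1)] by blast
  define m where "m l i = (if i < j then i else if i = j then j + l else i + N)" for l i
  have m: "strict_mono_on {..<k} (m l)" if "l < N" for l
    using that by (auto simp: strict_mono_on_def m_def)
  define b where "b = a(j := 0)"
  have split: "(\<Sum>i<k. a i *\<^sub>R e (m l i)) = (\<Sum>i<k. b i *\<^sub>R e (m 0 i)) + a j *\<^sub>R e (j + l)" for l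
  proof -
    have "(\<Sum>i<k. a i *\<^sub>R e (m l i)) = a j *\<^sub>R e (m l j) + (\<Sum>i\<in>{..<k} - {j}. a i *\<^sub>R e (m l i))"
      using j by (intro sum.remove) auto
    also have "(\<Sum>i\<in>{..<k} - {j}. a i *\<^sub>R e (m l i)) = (\<Sum>i\<in>{..<k} - {j}. b i *\<^sub>R e (m 0 i))"
      by (rule sum.cong) (auto simp: b_def m_def)
    also have "\<dots> = (\<Sum>i<k. b i *\<^sub>R e (m 0 i))"
      by (rule sum.mono_neutral_left) (auto simp: b_def)
    finally show ?thesis by (simp add: m_def)
  qed
  let ?X = "norm (\<Sum>i<k. a i *\<^sub>R e i)"
  have "(\<Sum>l<N. \<Sum>i<k. a i *\<^sub>R e (m l i))
      = real N *\<^sub>R (\<Sum>i<k. b i *\<^sub>R e (m 0 i)) + a j *\<^sub>R (\<Sum>l<N. e (j + l))"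
    unfolding split by (simp add: sum.distrib scaleR_sum_right sum_constant_scaleR)
  then have "real N *\<^sub>R (\<Sum>i<k. b i *\<^sub>R e (m 0 i))
      = (\<Sum>l<N. \<Sum>i<k. a i *\<^sub>R e (m l i)) - a j *\<^sub>R (\<Sum>l<N. e (j + l))"
    by simp
  then have "norm (real N *\<^sub>R (\<Sum>i<k. b i *\<^sub>R e (m 0 i)))
      \<le> norm (\<Sum>l<N. \<Sum>i<k. a i *\<^sub>R e (m l i)) + norm (a j *\<^sub>R (\<Sum>l<N. e (j + l)))"
    by (simp only: norm_triangle_ineq4)
  moreover have "norm (real N *\<^sub>R (\<Sum>i<k. b i *\<^sub>R e (m 0 i))) = real N * norm (\<Sum>i<k. b i *\<^sub>R e i)"
    using spreading_normD[OF sp m[OF N(1)], of b] by simp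
  moreover have "norm (\<Sum>l<N. \<Sum>i<k. a i *\<^sub>R e (m l i)) \<le> real N * ?X"
    using sum_norm_bound[of "{..<N}" "\<lambda>l. \<Sum>i<k. a i *\<^sub>R e (m l i)" ?X]
      spreading_normD[OF sp m, of _ a] by simp
  moreover have "norm (a j *\<^sub>R (\<Sum>l<N. e (j + l))) \<le> real N * d"
  proof -
    have "norm (\<Sum>l<N. e (j + l)) = norm (\<Sum>l<N. e l)"
      using spreading_shift[OF sp, where a="\<lambda>_. 1" and s=j and k=N] by (simp add: add.commute)
    then have "norm (a j *\<^sub>R (\<Sum>l<N. e (j + l))) \<le> \<bar>a j\<bar> * (r * real N)"
      using N(2) by (simp add: mult_left_mono)
    also have "\<dots> = (\<bar>a j\<bar> * r) * real N" by simp
    also have "\<dots> \<le> d * real N" using r(2) by (simp only: mult_right_mono of_nat_0_le_iff)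
    finally show ?thesis by (simp add: mult.commute)
  qed
  ultimately have "real N * norm (\<Sum>i<k. b i *\<^sub>R e i) \<le> real N * (?X + d)"
    unfolding distrib_left by linarith
  then have "norm (\<Sum>i<k. b i *\<^sub>R e i) \<le> norm (\<Sum>i<k. a i *\<^sub>R e i) + d" using N(1) by simp
  moreover have "(\<Sum>i\<in>{..<k} - {j}. a i *\<^sub>R e i) = (\<Sum>i<k. b i *\<^sub>R e i)"
    by (rule sum.mono_neutral_cong_left) (auto simp: b_def)
  ultimately show "norm (\<Sum>i\<in>{..<k} - {j}. a i *\<^sub>R e i) \<le> norm (\<Sum>i<k. a i *\<^sub>R e i) + d"
    by simp
qed

lemma spreading_suppression:
  assumes sp: "spreading e"
    and avg: "\<And>r. r > 0 \<Longrightarrow> \<exists>N>0. norm (\<Sum>l<N. e l) \<le> r * real N"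
    and G: "G \<subseteq> {..<k}"
  shows "norm (\<Sum>i\<in>{..<k} - G. a i *\<^sub>R e i) \<le> norm (\<Sum>i<k. a i *\<^sub>R e i)"
proof -
  have "finite G" using G finite_subset by blast
  then show ?thesis using G
  proof (induction G rule: finite_induct)
    case (insert j G)
    define b where "b i = (if i \<in> G then 0 else a i)" for i
    have "(\<Sum>i\<in>{..<k} - insert j G. a i *\<^sub>R e i) = (\<Sum>i\<in>{..<k} - {j}. b i *\<^sub>R e i)"
      by (rule sum.mono_neutral_cong_left) (auto simp: b_def)
    moreover have "norm \<dots> \<le> norm (\<Sum>i<k. b i *\<^sub>R e i)"
      using insert.prems by (intro spreading_remove_coordinate[OF sp _ avg]) auto
    moreover have "(\<Sum>i<k. b i *\<^sub>R e i) = (\<Sum>i\<in>{..<k} - G. a i *\<^sub>R e i)"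
      by (rule sum.mono_neutral_cong_right) (auto simp: b_def)
    ultimately show ?case using insert by simp
  qed simp
qed

text \<open>
  All shifts of \<open>\<Sum>i<k. a i *\<^sub>R e i\<close> have the same norm, and the sum of the first \<open>N\<close> shifts is
  \<open>(\<Sum>i<k. a i) *\<^sub>R (\<Sum>s<N. e s)\<close> up to boundary terms whose size does not depend on \<open>N\<close>.
\<close>

lemma spreading_sum_functional:
  assumes sp: "spreading e" and avg: "\<And>N. r * real N \<le> norm (\<Sum>l<N. e l)"
  shows "r * \<bar>\<Sum>i<k. a i\<bar> \<le> norm (\<Sum>i<k. a i *\<^sub>R e i)"
proof -
  let ?X = "norm (\<Sum>i<k. a i *\<^sub>R e i)"
  define A where "A = \<bar>\<Sum>i<k. a i\<bar>"
  define B where "B = (\<Sum>i<k. \<bar>a i\<bar>) * (2 * real k * norm (e 0))"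
  have boundary: "norm ((\<Sum>s<N. e (i + s)) - (\<Sum>s<N. e s)) \<le> 2 * real k * norm (e 0)"
    if i: "i < k" for i N
  proof -
    have "(\<Sum>s<i. e s) + (\<Sum>s<N. e (i + s)) = (\<Sum>s<N + i. e s)"
      using sum_lessThan_add[of e i N] by (simp add: add.commute)
    moreover have "(\<Sum>s<N + i. e s) = (\<Sum>s<N. e s) + (\<Sum>s<i. e (N + s))"
      by (rule sum_lessThan_add)
    ultimately have eq: "(\<Sum>s<N. e (i + s)) - (\<Sum>s<N. e s) = (\<Sum>s<i. e (N + s)) - (\<Sum>s<i. e s)"
      by (simp add: algebra_simps)
    have "norm (\<Sum>s<i. e (N + s)) \<le> real i * norm (e 0)"
      using sum_norm_bound[of "{..<i}" "\<lambda>s. e (N + s)" "norm (e 0)", OF eq_refl[OF spreading_norm_eq[OF sp]]]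
      by simp
    moreover have "norm (\<Sum>s<i. e s) \<le> real i * norm (e 0)"
      using sum_norm_bound[of "{..<i}" e "norm (e 0)", OF eq_refl[OF spreading_norm_eq[OF sp]]] by simp
    moreover have "real i * norm (e 0) \<le> real k * norm (e 0)" using i by (simp add: mult_right_mono)
    ultimately show ?thesis
      unfolding eq using norm_triangle_ineq4[of "\<Sum>s<i. e (N + s)" "\<Sum>s<i. e s"] by linarith
  qed
  have est: "r * A * real N \<le> real N * ?X + B" for N
  proof -
    have swap: "(\<Sum>s<N. \<Sum>i<k. a i *\<^sub>R e (i + s)) = (\<Sum>i<k. a i *\<^sub>R (\<Sum>s<N. e (i + s)))"
      by (subst sum.swap) (simp add: scaleR_sum_right)
    have eq: "(\<Sum>i<k. a i) *\<^sub>R (\<Sum>s<N. e s) = (\<Sum>s<N. \<Sum>i<k. a i *\<^sub>R e (i + s))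
        - (\<Sum>i<k. a i *\<^sub>R ((\<Sum>s<N. e (i + s)) - (\<Sum>s<N. e s)))"
      unfolding swap by (simp add: scaleR_diff_right sum_subtractf flip: scaleR_sum_left)
    have "r * A * real N \<le> A * norm (\<Sum>s<N. e s)"
      using mult_left_mono[OF avg[of N], of A] by (simp add: A_def mult_ac)
    also have "\<dots> = norm ((\<Sum>i<k. a i) *\<^sub>R (\<Sum>s<N. e s))" by (simp add: A_def)
    also have "\<dots> \<le> norm (\<Sum>s<N. \<Sum>i<k. a i *\<^sub>R e (i + s))
        + norm (\<Sum>i<k. a i *\<^sub>R ((\<Sum>s<N. e (i + s)) - (\<Sum>s<N. e s)))"
      unfolding eq by (rule norm_triangle_ineq4)
    also have "\<dots> \<le> real N * ?X + B"
    proof (rule add_mono)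
      show "norm (\<Sum>s<N. \<Sum>i<k. a i *\<^sub>R e (i + s)) \<le> real N * ?X"
        using sum_norm_bound[of "{..<N}" "\<lambda>s. \<Sum>i<k. a i *\<^sub>R e (i + s)" ?X]
          spreading_shift[OF sp, where k=k and a=a] by simp
      have "norm (\<Sum>i<k. a i *\<^sub>R ((\<Sum>s<N. e (i + s)) - (\<Sum>s<N. e s)))
          \<le> (\<Sum>i<k. \<bar>a i\<bar> * (2 * real k * norm (e 0)))"
        by (rule sum_norm_le) (use boundary in \<open>simp add: mult_left_mono\<close>)
      then show "norm (\<Sum>i<k. a i *\<^sub>R ((\<Sum>s<N. e (i + s)) - (\<Sum>s<N. e s))) \<le> B"
        by (simp add: B_def sum_distrib_right)
    qed
    finally show ?thesis .
  qed
  have "r * A - ?X \<le> 0"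
  proof (rule ccontr)
    assume "\<not> ?thesis"
    then have pos: "r * A - ?X > 0" by simp
    obtain N where "B < real N * (r * A - ?X)" using ex_less_of_nat_mult[OF pos] by blast
    then show False using est[of N] by (simp add: algebra_simps)
  qed
  then show ?thesis by (simp add: A_def)
qed

section \<open>Unconditional bases\<close>

definition basis_coeff :: "(nat \<Rightarrow> 'a::banach) \<Rightarrow> 'a \<Rightarrow> nat \<Rightarrow> real" where
  "basis_coeff e x = (THE a. (\<lambda>n. a n *\<^sub>R e n) sums x)"

definition coord_proj :: "(nat \<Rightarrow> 'a::banach) \<Rightarrow> nat set \<Rightarrow> 'a \<Rightarrow> 'a" where
  "coord_proj e F x = (\<Sum>i\<in>F. basis_coeff e x i *\<^sub>R e i)"

locale D_basis =
  fixes e :: "nat \<Rightarrow> 'a::banach" and D :: real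
  assumes D_basis: "D_unconditional_basis D e"
begin

lemma coeff_unique:
  assumes "(\<lambda>n. a n *\<^sub>R e n) sums x" shows "basis_coeff e x = a"
proof -
  have "\<exists>!a. (\<lambda>n. a n *\<^sub>R e n) sums x"
    using D_basis unfolding D_unconditional_basis_def unconditional_basis_def schauder_basis_def
    by blast
  then show ?thesis unfolding basis_coeff_def using assms by (intro the1_equality)
qed

lemma coeff_sums: "(\<lambda>n. basis_coeff e x n *\<^sub>R e n) sums x"
proof -
  have "\<exists>!a. (\<lambda>n. a n *\<^sub>R e n) sums x"
    using D_basis unfolding D_unconditional_basis_def unconditional_basis_def schauder_basis_def
    by blast
  then show ?thesis unfolding basis_coeff_def by (rule theI')
qed

lemma coeff_add: "basis_coeff e (x + y) n = basis_coeff e x n + basis_coeff e y n"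
proof -
  have "basis_coeff e (x + y) = (\<lambda>n. basis_coeff e x n + basis_coeff e y n)"
    using sums_add[OF coeff_sums coeff_sums] by (intro coeff_unique) (simp add: scaleR_add_left)
  then show ?thesis by simp
qed

lemma coeff_scaleR: "basis_coeff e (r *\<^sub>R x) n = r * basis_coeff e x n"
proof -
  have "basis_coeff e (r *\<^sub>R x) = (\<lambda>n. r * basis_coeff e x n)"
    using sums_scaleR_right[OF coeff_sums, of r x] by (intro coeff_unique) simp
  then show ?thesis by simp
qed

lemma coeff_diff: "basis_coeff e (x - y) n = basis_coeff e x n - basis_coeff e y n"
  using coeff_add[of x "(-1) *\<^sub>R y" n] coeff_scaleR[of "-1" y n] by simp

lemma coeff_sum:
  assumes "finite F"
  shows "basis_coeff e (\<Sum>i\<in>F. a i *\<^sub>R e i) = (\<lambda>n. if n \<in> F then a n else 0)"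
proof (rule coeff_unique)
  have "(\<lambda>n. if n \<in> F then a n *\<^sub>R e n else 0) sums (\<Sum>i\<in>F. a i *\<^sub>R e i)"
    by (rule sums_If_finite_set[OF assms])
  moreover have "(\<lambda>n. if n \<in> F then a n *\<^sub>R e n else 0) = (\<lambda>n. (if n \<in> F then a n else 0) *\<^sub>R e n)"
    by auto
  ultimately show "(\<lambda>n. (if n \<in> F then a n else 0) *\<^sub>R e n) sums (\<Sum>i\<in>F. a i *\<^sub>R e i)" by simp
qed

lemma coeff_proj: "finite F \<Longrightarrow> basis_coeff e (coord_proj e F x) n = (if n \<in> F then basis_coeff e x n else 0)"
  unfolding coord_proj_def by (simp add: coeff_sum)

lemma basis_nonzero: "e n \<noteq> 0"
proof
  assume "e n = 0"
  then have "basis_coeff e (\<Sum>i\<in>{n}. 1 *\<^sub>R e i) = basis_coeff e (\<Sum>i\<in>{n}. 0 *\<^sub>R e i)" by simp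
  then have "basis_coeff e (\<Sum>i\<in>{n}. 1 *\<^sub>R e i) n = basis_coeff e (\<Sum>i\<in>{n}. 0 *\<^sub>R e i) n" by simp
  then show False unfolding coeff_sum[OF finite.insertI[OF finite.emptyI]] by simp
qed

lemma proj_add: "coord_proj e F (x + y) = coord_proj e F x + coord_proj e F y"
  by (simp add: coord_proj_def coeff_add scaleR_add_left sum.distrib)

lemma proj_diff: "coord_proj e F (x - y) = coord_proj e F x - coord_proj e F y"
  by (simp add: coord_proj_def coeff_diff scaleR_diff_left sum_subtractf)

lemma proj_scaleR: "coord_proj e F (r *\<^sub>R x) = r *\<^sub>R coord_proj e F x"
  by (simp add: coord_proj_def coeff_scaleR scaleR_sum_right)

lemma proj_proj:
  assumes "finite G" "finite F"
  shows "coord_proj e G (coord_proj e F x) = coord_proj e (G \<inter> F) x"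
  using assms unfolding coord_proj_def[of e G] coord_proj_def[of e "G \<inter> F"]
  by (intro sum.mono_neutral_cong_right) (auto simp: coeff_proj)

lemma proj_union:
  "finite F \<Longrightarrow> finite G \<Longrightarrow> F \<inter> G = {} \<Longrightarrow> coord_proj e (F \<union> G) x = coord_proj e F x + coord_proj e G x"
  unfolding coord_proj_def by (rule sum.union_disjoint)

lemma proj_lessThan_tendsto: "(\<lambda>n. coord_proj e {..<n} x) \<longlonglongrightarrow> x"
  using coeff_sums[of x] unfolding sums_def coord_proj_def .

lemma sign_change_norm_le:
  assumes "(\<lambda>n. a n *\<^sub>R e n) sums x" "\<And>n. s n \<in> {-1, 1 :: real}"
  shows "norm (\<Sum>n. (s n * a n) *\<^sub>R e n) \<le> D * norm x"
  using D_basis assms unfolding D_unconditional_basis_def by simp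

text \<open>
  Only finitely many signs are changed, so the signed series has an explicit sum.  This is the form in
  which unconditionality is applied: it bounds the projections, hence the coefficients, and it compares
  the sum with the difference of two disjointly supported vectors.
\<close>

lemma norm_flip_le:
  assumes "finite F" shows "norm (x - 2 *\<^sub>R coord_proj e F x) \<le> D * norm x"
proof -
  let ?s = "\<lambda>n. if n \<in> F then - 1 else 1 :: real"
  have "(\<lambda>n. basis_coeff e x n *\<^sub>R e n - (if n \<in> F then 2 *\<^sub>R basis_coeff e x n *\<^sub>R e n else 0))
      sums (x - (\<Sum>n\<in>F. 2 *\<^sub>R basis_coeff e x n *\<^sub>R e n))"
    by (intro sums_diff coeff_sums sums_If_finite_set[OF assms])
  moreover have "(\<lambda>n. basis_coeff e x n *\<^sub>R e n - (if n \<in> F then 2 *\<^sub>R basis_coeff e x n *\<^sub>R e n else 0))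
      = (\<lambda>n. (?s n * basis_coeff e x n) *\<^sub>R e n)"
    by (auto simp: fun_eq_iff simp flip: scaleR_diff_left)
  ultimately have "(\<lambda>n. (?s n * basis_coeff e x n) *\<^sub>R e n) sums (x - 2 *\<^sub>R coord_proj e F x)"
    unfolding coord_proj_def scaleR_sum_right by (simp only:)
  then have "(\<Sum>n. (?s n * basis_coeff e x n) *\<^sub>R e n) = x - 2 *\<^sub>R coord_proj e F x"
    by (rule sums_unique[symmetric])
  moreover have "norm (\<Sum>n. (?s n * basis_coeff e x n) *\<^sub>R e n) \<le> D * norm x"
    by (rule sign_change_norm_le[OF coeff_sums]) simp
  ultimately show ?thesis by simp
qed

lemma D_ge_1: "1 \<le> D"
proof -
  have "norm (e 0) \<le> D * norm (e 0)" using norm_flip_le[of "{}" "e 0"] by (simp add: coord_proj_def)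
  then show ?thesis using basis_nonzero[of 0] by simp
qed

lemma norm_proj_le:
  assumes "finite F" shows "norm (coord_proj e F x) \<le> (1 + D) / 2 * norm x"
proof -
  have "norm (2 *\<^sub>R coord_proj e F x) \<le> norm x + norm (x - 2 *\<^sub>R coord_proj e F x)"
    using norm_triangle_ineq4[of x "x - 2 *\<^sub>R coord_proj e F x"] by simp
  then show ?thesis using norm_flip_le[OF assms, of x] by (simp add: algebra_simps)
qed

lemma bounded_linear_coeff: "bounded_linear (\<lambda>x. basis_coeff e x n)"
proof (rule bounded_linear_intro)
  fix x :: 'a
  have "\<bar>basis_coeff e x n\<bar> * norm (e n) \<le> (1 + D) / 2 * norm x"
    using norm_proj_le[of "{n}" x] by (simp add: coord_proj_def)
  then show "norm (basis_coeff e x n) \<le> norm x * ((1 + D) / 2 / norm (e n))"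
    using basis_nonzero[of n] by (simp add: field_simps)
qed (simp_all add: coeff_add coeff_scaleR)

lemma proj_small_if_coeff_small:
  assumes r: "r > 0"
  shows "\<exists>d>0. \<forall>x. (\<forall>i<n. \<bar>basis_coeff e x i\<bar> < d) \<longrightarrow> norm (coord_proj e {..<n} x) < r"
proof -
  define S where "S = (\<Sum>i<n. norm (e i))"
  have S: "S \<ge> 0" unfolding S_def by (simp add: sum_nonneg)
  let ?d = "r / (S + 1)"
  have "norm (coord_proj e {..<n} x) < r" if "\<forall>i<n. \<bar>basis_coeff e x i\<bar> < ?d" for x
  proof -
    have "norm (coord_proj e {..<n} x) \<le> (\<Sum>i<n. ?d * norm (e i))"
      unfolding coord_proj_def
    proof (rule sum_norm_le)
      fix i assume "i \<in> {..<n}"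
      then have "\<bar>basis_coeff e x i\<bar> \<le> ?d" using that less_imp_le by blast
      then show "norm (basis_coeff e x i *\<^sub>R e i) \<le> ?d * norm (e i)"
        unfolding norm_scaleR real_norm_def by (rule mult_right_mono) simp
    qed
    also have "\<dots> = ?d * S" by (simp add: S_def sum_distrib_left)
    also have "\<dots> < r" using r S by (simp add: field_simps)
    finally show ?thesis .
  qed
  then show ?thesis using r S by (intro exI[of _ ?d]) auto
qed

lemma bounded_linear_proj:
  assumes "finite F" shows "bounded_linear (coord_proj e F)"
  by (rule bounded_linear_intro[where K = "(1 + D) / 2"])
    (use norm_proj_le[OF assms] in \<open>simp_all add: proj_add proj_scaleR mult.commute\<close>)

lemma proj_tail_small:
  assumes "r > 0" shows "\<exists>m\<ge>n. norm (x - coord_proj e {..<m} x) < r"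
proof -
  have "\<forall>\<^sub>F m in sequentially. dist (coord_proj e {..<m} x) x < r"
    using proj_lessThan_tendsto assms by (rule tendstoD)
  then have "\<forall>\<^sub>F m in sequentially. m \<ge> n \<and> dist (coord_proj e {..<m} x) x < r"
    by (intro eventually_conj eventually_ge_at_top)
  then show ?thesis
    by (auto simp: eventually_sequentially dist_norm norm_minus_commute)
qed

text \<open>
  Contractivity on finite combinations passes to the limit of the partial sums.
\<close>

lemma suppression_norm_le:
  assumes sup: "\<And>k G a. G \<subseteq> {..<k} \<Longrightarrow>
      norm (\<Sum>i\<in>{..<k} - G. a i *\<^sub>R e i) \<le> norm (\<Sum>i<k. a i *\<^sub>R e i)"
    and F: "finite F"
  shows "norm (coord_proj e F x) \<le> norm x" and "norm (x - coord_proj e F x) \<le> norm x"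
proof -
  obtain k0 where k0: "F \<subseteq> {..<k0}" using F finite_nat_iff_bounded by blast
  have lim: "(\<lambda>k. norm (coord_proj e {..<k} x)) \<longlonglongrightarrow> norm x"
    by (intro tendsto_norm proj_lessThan_tendsto)
  have 1: "norm (coord_proj e F x) \<le> norm (coord_proj e {..<k} x)" if "k \<ge> k0" for k
  proof -
    have "{..<k} - ({..<k} - F) = F" using k0 that by auto
    then show ?thesis
      using sup[of "{..<k} - F" k "basis_coeff e x"] unfolding coord_proj_def by auto
  qed
  then show "norm (coord_proj e F x) \<le> norm x" by (intro LIMSEQ_le_const[OF lim]) blast
  have 2: "norm (coord_proj e {..<k} x - coord_proj e F x) \<le> norm (coord_proj e {..<k} x)" if "k \<ge> k0" for k
  proof -
    have "F \<subseteq> {..<k}" using k0 that by auto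
    then show ?thesis
      using sup[of F k "basis_coeff e x"] sum_diff[of "{..<k}" F "\<lambda>i. basis_coeff e x i *\<^sub>R e i"]
      unfolding coord_proj_def by simp
  qed
  have "(\<lambda>k. norm (coord_proj e {..<k} x - coord_proj e F x)) \<longlonglongrightarrow> norm (x - coord_proj e F x)"
    by (intro tendsto_norm tendsto_diff proj_lessThan_tendsto tendsto_const)
  from LIMSEQ_le[OF this lim] show "norm (x - coord_proj e F x) \<le> norm x" using 2 by blast
qed

text \<open>
  Flipping the negative coefficients reduces the sum of absolute values to a plain sum.
\<close>

lemma sum_abs_coeff_le:
  assumes low: "\<And>k a. r * \<bar>\<Sum>i<k. a i\<bar> \<le> norm (\<Sum>i<k. a i *\<^sub>R e i)" and F: "finite F"
  shows "r * (\<Sum>i\<in>F. \<bar>basis_coeff e x i\<bar>) \<le> D * norm (coord_proj e F x)"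
proof -
  obtain k where k: "F \<subseteq> {..<k}" using F finite_nat_iff_bounded by blast
  let ?y = "coord_proj e F x" and ?N = "{i\<in>F. basis_coeff e x i < 0}"
  define a where "a i = (if i \<in> F then \<bar>basis_coeff e x i\<bar> else 0)" for i
  have "coord_proj e ?N ?y = coord_proj e ?N x"
    unfolding coord_proj_def[of e ?N] using F by (intro sum.cong) (auto simp: coeff_proj)
  also have "\<dots> = (\<Sum>i\<in>F. if basis_coeff e x i < 0 then basis_coeff e x i *\<^sub>R e i else 0)"
    unfolding coord_proj_def using F by (rule sum.inter_filter)
  finally have "?y - 2 *\<^sub>R coord_proj e ?N ?y
      = (\<Sum>i\<in>F. basis_coeff e x i *\<^sub>R e i - 2 *\<^sub>R (if basis_coeff e x i < 0 then basis_coeff e x i *\<^sub>R e i else 0))"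
    by (simp add: coord_proj_def[of e F] sum_subtractf scaleR_sum_right)
  also have "\<dots> = (\<Sum>i\<in>F. a i *\<^sub>R e i)"
    by (rule sum.cong) (auto simp: a_def simp flip: scaleR_diff_left)
  also have "\<dots> = (\<Sum>i<k. a i *\<^sub>R e i)"
    using k by (intro sum.mono_neutral_left) (auto simp: a_def)
  finally have "norm (\<Sum>i<k. a i *\<^sub>R e i) \<le> D * norm ?y"
    using norm_flip_le[of ?N ?y] F by simp
  moreover have "(\<Sum>i<k. a i) = (\<Sum>i\<in>F. \<bar>basis_coeff e x i\<bar>)"
    using k by (intro sum.mono_neutral_cong_right) (auto simp: a_def)
  ultimately show ?thesis using low[of a k] by (simp add: sum_nonneg)
qed

lemma signed_sum_functional:
  assumes r: "r > 0" and low: "\<And>k a. r * \<bar>\<Sum>i<k. a i\<bar> \<le> norm (\<Sum>i<k. a i *\<^sub>R e i)"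
    and s: "\<And>i. \<bar>s i\<bar> \<le> (1::real)"
  defines "g \<equiv> \<lambda>x. \<Sum>i. s i * basis_coeff e x i"
  shows "bounded_linear g" and "\<bar>g x\<bar> \<le> norm x * (D * (1 + D) / (2 * r))"
    and "finite F \<Longrightarrow> g (coord_proj e F x) = (\<Sum>i\<in>F. s i * basis_coeff e x i)"
proof -
  let ?K = "D * (1 + D) / (2 * r)"
  have part: "(\<Sum>i<k. \<bar>basis_coeff e x i\<bar>) \<le> norm x * ?K" for x k
  proof -
    have "r * (\<Sum>i<k. \<bar>basis_coeff e x i\<bar>) \<le> D * norm (coord_proj e {..<k} x)"
      by (rule sum_abs_coeff_le[OF low]) simp
    also have "\<dots> \<le> D * ((1 + D) / 2 * norm x)"
      using norm_proj_le[of "{..<k}" x] D_ge_1 by (intro mult_left_mono) auto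
    finally show ?thesis using r by (simp add: field_simps)
  qed
  have summable_abs: "summable (\<lambda>i. \<bar>basis_coeff e x i\<bar>)" for x
    by (rule summableI_nonneg_bounded[OF _ part]) simp
  have le: "norm (s i * basis_coeff e x i) \<le> \<bar>basis_coeff e x i\<bar>" for i x
    using s[of i] by (simp add: abs_mult mult_left_le_one_le)
  have summable: "summable (\<lambda>i. s i * basis_coeff e x i)" for x
    by (rule summable_comparison_test'[OF summable_abs le])
  have bound: "\<bar>g x\<bar> \<le> norm x * ?K" for x
  proof -
    have "norm (g x) \<le> (\<Sum>i. \<bar>basis_coeff e x i\<bar>)"
      unfolding g_def using summable_abs le by (rule norm_suminf_le[rotated])
    also have "\<dots> \<le> norm x * ?K"
      using part by (intro suminf_le_const summable_abs)
    finally show ?thesis by simp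
  qed
  then show "\<bar>g x\<bar> \<le> norm x * ?K" .
  show "bounded_linear g"
  proof (rule bounded_linear_intro[where K = ?K])
    show "g (x + y) = g x + g y" for x y
      unfolding g_def using suminf_add[OF summable summable, of x y]
      by (simp add: coeff_add distrib_left)
    show "g (t *\<^sub>R x) = t *\<^sub>R g x" for t x
      unfolding g_def using suminf_mult[OF summable, of t x]
      by (simp add: coeff_scaleR mult.left_commute)
  qed (use bound in simp)
  show "g (coord_proj e F x) = (\<Sum>i\<in>F. s i * basis_coeff e x i)" if F: "finite F"
  proof -
    have "g (coord_proj e F x) = (\<Sum>i\<in>F. s i * basis_coeff e (coord_proj e F x) i)"
      unfolding g_def using F by (intro suminf_finite) (auto simp: coeff_proj)
    then show ?thesis using F by (simp add: coeff_proj)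
  qed
qed

end


section \<open>Fixed points when block projections are contractions\<close>

text \<open>
  Here \<open>y\<close>, \<open>u\<close>, \<open>v\<close> live, up to \<open>\<epsilon>\<close>, on the consecutive blocks \<open>{..<N}\<close>, \<open>{N..<M}\<close> and
  \<open>{M..<L}\<close>.  Removing from \<open>w\<close> the block of \<open>u\<close> or of \<open>v\<close> makes that vector invisible, and keeping
  only those two blocks makes \<open>y\<close> invisible; \<open>2 w\<close> is the sum of the three resulting pieces.
\<close>

lemma (in D_basis) separated_blocks_estimate:
  assumes contr: "\<And>F x. finite F \<Longrightarrow> norm (coord_proj e F x) \<le> norm x"
      "\<And>F x. finite F \<Longrightarrow> norm (x - coord_proj e F x) \<le> norm x"
    and NML: "N \<le> M" "M \<le> L"
    and y: "norm (y - coord_proj e {..<N} y) \<le> \<epsilon>"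
    and u: "norm (coord_proj e {..<N} u) \<le> \<epsilon>" "norm (u - coord_proj e {..<M} u) \<le> \<epsilon>"
    and v: "norm (coord_proj e {..<M} v) \<le> \<epsilon>" "norm (v - coord_proj e {..<L} v) \<le> \<epsilon>"
  shows "2 * norm w \<le> norm (w - u) + norm (w - v) + norm (w - y) + 5 * \<epsilon>"
    and "norm (u + v) \<le> D * norm (u - v) + (4 + 4 * D) * \<epsilon>"
proof -
  let ?A = "{N..<M}" and ?B = "{M..<L}"
  have split: "coord_proj e {..<n} x = coord_proj e {..<m} x + coord_proj e {m..<n} x" if "m \<le> n" for m n x
  proof -
    have "{..<n} = {..<m} \<union> {m..<n}" using that by auto
    then show ?thesis by (simp add: proj_union ivl_disj_int)
  qed
  have uA: "norm (u - coord_proj e ?A u) \<le> 2 * \<epsilon>"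
  proof -
    have eq: "u - coord_proj e ?A u = (u - coord_proj e {..<M} u) + coord_proj e {..<N} u"
      using split[OF NML(1)] by simp
    show ?thesis unfolding eq using u norm_triangle_ineq[of "u - coord_proj e {..<M} u" "coord_proj e {..<N} u"] by simp
  qed
  have vB: "norm (v - coord_proj e ?B v) \<le> 2 * \<epsilon>"
  proof -
    have eq: "v - coord_proj e ?B v = (v - coord_proj e {..<L} v) + coord_proj e {..<M} v"
      using split[OF NML(2)] by simp
    show ?thesis unfolding eq using v norm_triangle_ineq[of "v - coord_proj e {..<L} v" "coord_proj e {..<M} v"] by simp
  qed
  have remove: "norm (w - coord_proj e F w) \<le> norm (w - x) + 2 * \<epsilon>"
    if "finite F" "norm (x - coord_proj e F x) \<le> 2 * \<epsilon>" for F x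
  proof -
    have eq: "w - coord_proj e F w = ((w - x) - coord_proj e F (w - x)) + (x - coord_proj e F x)"
      by (simp add: proj_diff)
    show ?thesis
      unfolding eq using contr(2)[OF that(1), of "w - x"] that(2)
        norm_triangle_ineq[of "(w - x) - coord_proj e F (w - x)" "x - coord_proj e F x"] by linarith
  qed
  have keep: "norm (coord_proj e ?A w + coord_proj e ?B w) \<le> norm (w - y) + \<epsilon>"
  proof -
    let ?F = "?A \<union> ?B"
    have "coord_proj e ?F (coord_proj e {..<N} y) = coord_proj e (?F \<inter> {..<N}) y" by (rule proj_proj) auto
    also have "?F \<inter> {..<N} = {}" using NML by auto
    finally have "coord_proj e ?F y = coord_proj e ?F (y - coord_proj e {..<N} y)"
      by (simp add: proj_diff) (simp add: coord_proj_def)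
    then have eq: "coord_proj e ?A w + coord_proj e ?B w = coord_proj e ?F (w - y) + coord_proj e ?F (y - coord_proj e {..<N} y)"
      by (simp add: proj_diff ivl_disj_int flip: proj_union)
    have "finite ?F" by simp
    from contr(1)[OF this, of "w - y"] contr(1)[OF this, of "y - coord_proj e {..<N} y"] show ?thesis
      unfolding eq using y
        norm_triangle_ineq[of "coord_proj e ?F (w - y)" "coord_proj e ?F (y - coord_proj e {..<N} y)"] by linarith
  qed
  have "2 *\<^sub>R w = (w - coord_proj e ?A w) + (w - coord_proj e ?B w) + (coord_proj e ?A w + coord_proj e ?B w)"
    by (simp add: scaleR_2)
  then have "norm (2 *\<^sub>R w) \<le> norm (w - coord_proj e ?A w) + norm (w - coord_proj e ?B w)
      + norm (coord_proj e ?A w + coord_proj e ?B w)"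
    by (metis norm_triangle_mono norm_triangle_ineq order_refl)
  then show "2 * norm w \<le> norm (w - u) + norm (w - v) + norm (w - y) + 5 * \<epsilon>"
    using remove[OF _ uA] remove[OF _ vB] keep by simp
  define a where "a = coord_proj e ?A u"
  define b where "b = coord_proj e ?B v"
  have "coord_proj e ?B (a - b) = - b"
    by (simp add: a_def b_def proj_diff proj_proj ivl_disj_int) (simp add: coord_proj_def)
  then have "norm (a + b) \<le> D * norm (a - b)"
    using norm_flip_le[of ?B "a - b"] by (simp add: scaleR_2)
  also have "\<dots> \<le> D * (norm (u - v) + 4 * \<epsilon>)"
  proof (rule mult_left_mono)
    have "a - b = (u - v) - (u - a) + (v - b)" by simp
    then have "norm (a - b) \<le> norm (u - v) + norm (u - a) + norm (v - b)"
      by (metis norm_triangle_ineq norm_triangle_ineq4 norm_triangle_mono order_refl)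
    then show "norm (a - b) \<le> norm (u - v) + 4 * \<epsilon>" using uA vB by (simp add: a_def b_def)
  qed (use D_ge_1 in simp)
  finally have ab: "norm (a + b) \<le> D * (norm (u - v) + 4 * \<epsilon>)" .
  have "u + v = (a + b) + (u - a) + (v - b)" by simp
  then have "norm (u + v) \<le> norm (a + b) + norm (u - a) + norm (v - b)"
    by (metis norm_triangle_ineq norm_triangle_mono order_refl)
  then show "norm (u + v) \<le> D * norm (u - v) + (4 + 4 * D) * \<epsilon>"
    using ab uA vB by (simp add: a_def b_def algebra_simps)
qed

text \<open>
  The defining equation of \<open>w\<close> (with \<open>t = T w\<close> and \<open>s = T u\<close>) bounds \<open>\<parallel>w - u\<parallel>\<close> by
  \<open>(1 - l) \<parallel>w - u\<parallel>\<close> plus \<open>l\<close> times the right-hand side; an error \<open>l \<epsilon>\<close> in \<open>u\<close> being a fixed point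
  is therefore harmless however small \<open>l\<close> is.
\<close>

lemma damped_norm_le:
  fixes w :: "'a::real_normed_vector"
  assumes w: "w = (1 - l) *\<^sub>R t + l *\<^sub>R z" and l: "0 < l" "l \<le> 1"
    and t: "norm (t - s) \<le> norm (w - u)" and s: "norm (s - u) \<le> l * \<epsilon>"
  shows "norm (w - u) \<le> norm (z - u) + \<epsilon>"
proof -
  have "w - u = (1 - l) *\<^sub>R (t - s) + ((1 - l) *\<^sub>R (s - u) + l *\<^sub>R (z - u))"
    unfolding w by (simp add: algebra_simps)
  then have "norm (w - u) \<le> norm ((1 - l) *\<^sub>R (t - s)) + (norm ((1 - l) *\<^sub>R (s - u)) + norm (l *\<^sub>R (z - u)))"
    by (metis norm_triangle_ineq norm_triangle_mono order_refl)
  moreover have "norm ((1 - l) *\<^sub>R (t - s)) \<le> (1 - l) * norm (w - u)"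
    using t l by (simp add: mult_left_mono)
  moreover have "norm ((1 - l) *\<^sub>R (s - u)) \<le> l * \<epsilon>"
  proof -
    have "(1 - l) * norm (s - u) \<le> 1 * norm (s - u)" using l by (intro mult_right_mono) auto
    then show ?thesis using s l by simp
  qed
  moreover have "norm (l *\<^sub>R (z - u)) = l * norm (z - u)" using l by simp
  ultimately have "norm (w - u) \<le> (1 - l) * norm (w - u) + (l * \<epsilon> + l * norm (z - u))"
    by linarith
  then have "l * norm (w - u) \<le> l * (norm (z - u) + \<epsilon>)"
    by (simp add: algebra_simps)
  then show ?thesis using l by simp
qed

text \<open>
  Lin's argument, with all vectors measured from the weak cluster point \<open>x0\<close>.  The order of choices
  matters: first the damping \<open>l\<close>, which fixes \<open>y\<close>, then \<open>u\<close> beyond the essential support of \<open>y\<close>, then \<open>v\<close>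
  beyond that of \<open>u\<close>.
\<close>

lemma (in D_basis) fixed_point_if_projections_contract:
  fixes C :: "'a set"
  assumes contr: "\<And>F x. finite F \<Longrightarrow> norm (coord_proj e F x) \<le> norm x"
      "\<And>F x. finite F \<Longrightarrow> norm (x - coord_proj e F x) \<le> norm x"
    and D: "D < 2"
    and C: "compactin weak_topology C" "convex C" "C \<noteq> {}"
    and T: "T \<in> C \<rightarrow> C" "1-lipschitz_on C T"
  shows "\<exists>x\<in>C. T x = x"
proof (rule ccontr)
  assume nofix: "\<not> (\<exists>x\<in>C. T x = x)"
  obtain K where KC: "K \<subseteq> C" and K: "minimal_invariant T K"
    using exists_minimal_invariant[OF C T(1)] by blast
  have inv: "K \<noteq> {}" "closed K" "convex K" "T \<in> K \<rightarrow> K"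
    using K unfolding minimal_invariant_def invariant_convex_def by auto
  have wK: "compactin weak_topology K"
    by (rule weakly_compact_closed_convex_subset[OF C(1) KC inv(2,3)])
  have TK: "1-lipschitz_on K T" using T(2) KC by (rule lipschitz_on_subset)
  have nonexp: "norm (T a - T b) \<le> norm (a - b)" if "a \<in> K" "b \<in> K" for a b
    using lipschitz_onD[OF TK that] by (simp add: dist_norm)
  obtain x0 where x0: "x0 \<in> K" and cluster: "\<And>d F r. d > 0 \<Longrightarrow> finite F \<Longrightarrow>
      (\<And>f. f \<in> F \<Longrightarrow> bounded_linear f) \<Longrightarrow> r > 0 \<Longrightarrow>
      \<exists>u\<in>K. norm (T u - u) \<le> d \<and> (\<forall>f\<in>F. \<bar>f (u - x0) :: real\<bar> < r)"
    using weak_cluster_approximate_fixed_points[OF wK inv(3,1,4) TK] by metis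
  have far: "\<exists>u\<in>K. norm (T u - u) \<le> d \<and> norm (coord_proj e {..<n} (u - x0)) < r"
    if d: "d > 0" and r: "r > 0" for d r n
  proof -
    obtain q where q: "q > 0" "\<And>x. \<forall>i<n. \<bar>basis_coeff e x i\<bar> < q \<Longrightarrow> norm (coord_proj e {..<n} x) < r"
      using proj_small_if_coeff_small[OF r] by blast
    obtain u where "u \<in> K" "norm (T u - u) \<le> d"
        "\<forall>f\<in>(\<lambda>i x. basis_coeff e x i) ` {..<n}. \<bar>f (u - x0)\<bar> < q"
      using cluster[OF d _ _ q(1), of "(\<lambda>i x. basis_coeff e x i) ` {..<n}"] bounded_linear_coeff by auto
    then show ?thesis using q(2) by auto
  qed
  define d where "d = diameter K"
  have diam: "norm (a - b) \<le> d" if "a \<in> K" "b \<in> K" for a b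
    using diameter_bounded_bound[OF weakly_compact_imp_bounded[OF wK] that] by (simp add: d_def dist_norm)
  have d: "d > 0"
  proof -
    have "T x0 \<in> K" "T x0 \<noteq> x0" using x0 KC inv(4) nofix by auto
    then have "norm (T x0 - x0) > 0" by simp
    then show ?thesis using diam[OF \<open>T x0 \<in> K\<close> x0] by linarith
  qed
  \<comment> \<open>The gap between \<open>(1/2 + D/4) d\<close> and \<open>d\<close> is \<open>2 g\<close>: half of it absorbs the errors,
    half keeps \<open>r\<close> below \<open>d\<close>.\<close>
  define g where "g = d * (2 - D) / 8"
  have g: "g > 0" using d D by (simp add: g_def)
  define r where "r = d * (1/2 + D/4) + g"
  have rd: "r < d" using d D by (simp add: r_def g_def field_simps)
  define \<epsilon> where "\<epsilon> = g / 8"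
  have \<epsilon>: "\<epsilon> > 0" using g by (simp add: \<epsilon>_def)
  have "\<exists>w\<in>K. norm (T w - w) \<le> \<delta> \<and> norm (w - x0) \<le> r" if \<delta>: "\<delta> > 0" for \<delta>
  proof -
    define l where "l = min 1 (\<delta> / d)"
    have l: "0 < l" "l \<le> 1" "l * d \<le> \<delta>" using \<delta> d by (auto simp: l_def min_def field_simps)
    have l\<epsilon>: "l * \<epsilon> > 0" using l \<epsilon> by simp
    obtain y where y: "y \<in> K" "y = (1 - l) *\<^sub>R T y + l *\<^sub>R x0"
      using damped_fixed_point[OF inv(2-4) TK x0 l(1,2)] by blast
    obtain N where N: "norm ((y - x0) - coord_proj e {..<N} (y - x0)) < \<epsilon>"
      using proj_tail_small[OF \<epsilon>] by blast
    obtain u where u: "u \<in> K" "norm (T u - u) \<le> l * \<epsilon>" "norm (coord_proj e {..<N} (u - x0)) < \<epsilon>"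
      using far[OF l\<epsilon> \<epsilon>] by blast
    obtain M where M: "M \<ge> N" "norm ((u - x0) - coord_proj e {..<M} (u - x0)) < \<epsilon>"
      using proj_tail_small[OF \<epsilon>] by blast
    obtain v where v: "v \<in> K" "norm (T v - v) \<le> l * \<epsilon>" "norm (coord_proj e {..<M} (v - x0)) < \<epsilon>"
      using far[OF l\<epsilon> \<epsilon>] by blast
    obtain L where L: "L \<ge> M" "norm ((v - x0) - coord_proj e {..<L} (v - x0)) < \<epsilon>"
      using proj_tail_small[OF \<epsilon>] by blast
    define z where "z = (1/2) *\<^sub>R u + (1/2) *\<^sub>R v"
    have z: "z \<in> K" unfolding z_def using inv(3) u(1) v(1) by (intro convexD) auto
    obtain w where w: "w \<in> K" "w = (1 - l) *\<^sub>R T w + l *\<^sub>R z"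
      using damped_fixed_point[OF inv(2-4) TK z l(1,2)] by blast
    note est = separated_blocks_estimate[OF contr M(1) L(1) less_imp_le[OF N] less_imp_le[OF u(3)]
        less_imp_le[OF M(2)] less_imp_le[OF v(3)] less_imp_le[OF L(2)]]
    have "norm (w - y) \<le> norm (z - x0)"
    proof -
      have "w - y = ((1 - l) *\<^sub>R T w + l *\<^sub>R z) - ((1 - l) *\<^sub>R T y + l *\<^sub>R x0)"
        using w(2) y(2) by simp
      also have "\<dots> = (1 - l) *\<^sub>R (T w - T y) + l *\<^sub>R (z - x0)" by (simp add: algebra_simps)
      finally have "norm (w - y) \<le> norm ((1 - l) *\<^sub>R (T w - T y)) + norm (l *\<^sub>R (z - x0))"
        by (simp only: norm_triangle_ineq)
      moreover have "norm ((1 - l) *\<^sub>R (T w - T y)) \<le> (1 - l) * norm (w - y)"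
        using nonexp[OF w(1) y(1)] l by (simp add: mult_left_mono)
      moreover have "norm (l *\<^sub>R (z - x0)) = l * norm (z - x0)" using l by simp
      ultimately have "norm (w - y) \<le> (1 - l) * norm (w - y) + l * norm (z - x0)" by linarith
      then have "l * norm (w - y) \<le> l * norm (z - x0)" by (simp add: algebra_simps)
      then show ?thesis using l by simp
    qed
    also have "norm (z - x0) = norm ((u - x0) + (v - x0)) / 2"
    proof -
      have "z - x0 = (1/2) *\<^sub>R ((u - x0) + (v - x0))"
        unfolding z_def by (simp add: algebra_simps flip: scaleR_add_left)
      then show ?thesis by simp
    qed
    also have "\<dots> \<le> (D * norm ((u - x0) - (v - x0)) + (4 + 4 * D) * \<epsilon>) / 2"
      using est(2) by simp
    also have "\<dots> \<le> (D * d + (4 + 4 * D) * \<epsilon>) / 2"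
      using diam[OF u(1) v(1)] D_ge_1 by (simp add: mult_left_mono)
    finally have wy: "norm (w - y) \<le> (D * d + (4 + 4 * D) * \<epsilon>) / 2" .
    have zu: "norm (z - u) \<le> d / 2"
    proof -
      have "z - u = (1/2) *\<^sub>R (v - u)" unfolding z_def by (simp add: algebra_simps flip: scaleR_add_left)
      then show ?thesis using diam[OF v(1) u(1)] by simp
    qed
    have zv: "norm (z - v) \<le> d / 2"
    proof -
      have "z - v = (1/2) *\<^sub>R (u - v)" unfolding z_def by (simp add: algebra_simps flip: scaleR_add_left)
      then show ?thesis using diam[OF u(1) v(1)] by simp
    qed
    have wu: "norm (w - u) \<le> d / 2 + \<epsilon>"
      using damped_norm_le[OF w(2) l(1,2) nonexp[OF w(1) u(1)] u(2)] zu by simp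
    have wv: "norm (w - v) \<le> d / 2 + \<epsilon>"
      using damped_norm_le[OF w(2) l(1,2) nonexp[OF w(1) v(1)] v(2)] zv by simp
    have "2 * norm (w - x0) \<le> norm (w - u) + norm (w - v) + norm (w - y) + 5 * \<epsilon>"
      using est(1)[of "w - x0"] by simp
    also have "\<dots> \<le> d + D * d / 2 + 9 * \<epsilon> + 2 * (D * \<epsilon>)"
      using wu wv wy by (simp add: field_simps)
    also have "\<dots> \<le> d + D * d / 2 + 13 * \<epsilon>"
      using D \<epsilon> by simp
    also have "\<dots> \<le> 2 * r" using g by (simp add: r_def \<epsilon>_def field_simps)
    finally have "norm (w - x0) \<le> r" by simp
    moreover have "T w \<in> K" using w(1) inv(4) by blast
    then have "norm (T w - w) \<le> \<delta>"
      using damped_fixed_point_displacement[OF w(2) _ diam[OF _ z]] l by force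
    ultimately show ?thesis using w(1) by blast
  qed
  then have "norm (a - b) \<le> r" if "a \<in> K" "b \<in> K" for a b
    using minimal_invariant_diameter[OF K wK TK _ x0 that] by blast
  then have "diameter K \<le> r" using inv(1) by (intro diameter_le) auto
  then show False using rd by (simp add: d_def)
qed

section \<open>Fixed points when the basis behaves like that of \<open>\<ell>\<^sub>1\<close>\<close>

lemma closed_vimage_bounded_linear:
  assumes "bounded_linear f" "closed S" shows "closed (f -` S)"
  by (rule closed_vimage[OF assms(2) linear_continuous_on[OF assms(1)]])

text \<open>
  A weak cluster point \<open>x0\<close> of approximate fixed points that is not fixed has positive distance from all
  sufficiently accurate ones.  Choose such points inductively so that the differences from \<open>x0\<close> are essentially supported on
  successive blocks, and let \<open>g\<close> be the functional whose sign pattern matches each of them on its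
  block.  It is at least some \<open>\<kappa> > 0\<close> on all differences, although weak compactness forces these to
  have the weak cluster point \<open>0\<close>.
\<close>

lemma (in D_basis) fixed_point_if_sum_bounded:
  fixes C :: "'a set"
  assumes r: "r > 0" and low: "\<And>k a. r * \<bar>\<Sum>i<k. a i\<bar> \<le> norm (\<Sum>i<k. a i *\<^sub>R e i)"
    and E: "\<And>i. norm (e i) \<le> E"
    and C: "compactin weak_topology C" "convex C" "C \<noteq> {}"
    and T: "T \<in> C \<rightarrow> C" "1-lipschitz_on C T"
  shows "\<exists>x\<in>C. T x = x"
proof (rule ccontr)
  assume nofix: "\<not> (\<exists>x\<in>C. T x = x)"
  have nonexp: "norm (T a - T b) \<le> norm (a - b)" if "a \<in> C" "b \<in> C" for a b
    using lipschitz_onD[OF T(2) that] by (simp add: dist_norm)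
  obtain x0 where x0: "x0 \<in> C" and cluster: "\<And>d F r. d > 0 \<Longrightarrow> finite F \<Longrightarrow>
      (\<And>f. f \<in> F \<Longrightarrow> bounded_linear f) \<Longrightarrow> r > 0 \<Longrightarrow>
      \<exists>u\<in>C. norm (T u - u) \<le> d \<and> (\<forall>f\<in>F. \<bar>f (u - x0) :: real\<bar> < r)"
    using weak_cluster_approximate_fixed_points[OF C T] by metis
  define \<tau> where "\<tau> = norm (T x0 - x0)"
  have \<tau>: "\<tau> > 0" using nofix x0 by (auto simp: \<tau>_def)
  define A where "A = {u\<in>C. norm (T u - u) \<le> \<tau> / 2}"
  have A: "\<tau> / 4 \<le> norm (u - x0)" if "u \<in> A" for u
  proof -
    have "T x0 - x0 = (T x0 - T u) + (T u - u) + (u - x0)" by simp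
    then have "\<tau> \<le> norm (T x0 - T u) + norm (T u - u) + norm (u - x0)"
      unfolding \<tau>_def by (metis norm_triangle_ineq norm_triangle_mono order_refl)
    then show ?thesis
      using nonexp[OF x0, of u] that by (auto simp: A_def norm_minus_commute)
  qed
  have far: "\<exists>u\<in>A. norm (coord_proj e {..<n} (u - x0)) < r" if r: "r > 0" for r n
  proof -
    obtain q where q: "q > 0" "\<And>x. \<forall>i<n. \<bar>basis_coeff e x i\<bar> < q \<Longrightarrow> norm (coord_proj e {..<n} x) < r"
      using proj_small_if_coeff_small[OF r] by blast
    obtain u where "u \<in> C" "norm (T u - u) \<le> \<tau> / 2"
        "\<forall>f\<in>(\<lambda>i x. basis_coeff e x i) ` {..<n}. \<bar>f (u - x0)\<bar> < q"
      using cluster[OF _ _ _ q(1), of "\<tau> / 2" "(\<lambda>i x. basis_coeff e x i) ` {..<n}"] \<tau> bounded_linear_coeff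
      by auto
    then show ?thesis using q(2) by (auto simp: A_def)
  qed
  have E0: "E > 0" using E[of 0] basis_nonzero[of 0] by (meson less_le_trans zero_less_norm_iff)
  define K where "K = D * (1 + D) / (2 * r)"
  have K: "K > 0" using r D_ge_1 by (simp add: K_def)
  \<comment> \<open>A difference has norm at least \<open>\<tau> / 4\<close>, so its coefficients have absolute sum at least
    \<open>2 \<kappa>\<close>; the choice of \<open>\<eta>\<close> makes the loss outside the block equal to \<open>\<kappa>\<close>.\<close>
  define \<kappa> where "\<kappa> = \<tau> / (8 * E)"
  have \<kappa>: "\<kappa> > 0" using \<tau> E0 by (simp add: \<kappa>_def)
  define \<eta> where "\<eta> = \<kappa> / (2 / E + 2 * K)"
  have \<eta>: "\<eta> > 0" using \<kappa> E0 K by (simp add: \<eta>_def add_pos_pos)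
  have \<eta>\<kappa>: "2 * \<eta> / E + 2 * \<eta> * K = \<kappa>"
  proof -
    have "2 / E + 2 * K > 0" using E0 K by (simp add: add_pos_pos)
    then have "\<eta> * (2 / E + 2 * K) = \<kappa>" by (simp add: \<eta>_def)
    then show ?thesis by (simp add: algebra_simps)
  qed
  \<comment> \<open>The gliding hump: a state consists of the left end of the block and the approximate
    fixed point chosen for it; the right end is the left end of the next block.\<close>
  obtain S where S: "\<And>n. snd (S n) \<in> A"
      "\<And>n. norm (coord_proj e {..<fst (S n)} (snd (S n) - x0)) < \<eta> / real (Suc n)"
      "\<And>n. fst (S n) < fst (S (Suc n))"
      "\<And>n. norm ((snd (S n) - x0) - coord_proj e {..<fst (S (Suc n))} (snd (S n) - x0)) < \<eta>"
  proof -
    let ?P = "\<lambda>n s. snd s \<in> A \<and> norm (coord_proj e {..<fst s} (snd s - x0)) < \<eta> / real (Suc n)"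
    let ?Q = "\<lambda>n s t. fst s < fst t \<and> norm ((snd s - x0) - coord_proj e {..<fst t} (snd s - x0)) < \<eta>"
    have "\<exists>S. \<forall>n. ?P n (S n) \<and> ?Q n (S n) (S (Suc n))"
    proof (rule dependent_nat_choice)
      show "\<exists>s. ?P 0 s"
      proof -
        obtain u where "u \<in> A" "norm (coord_proj e {..<0} (u - x0)) < \<eta>" using far[OF \<eta>] by blast
        then show ?thesis by (intro exI[of _ "(0, u)"]) simp
      qed
      fix s :: "nat \<times> 'a" and n assume "?P n s"
      obtain m where m: "m \<ge> Suc (fst s)" "norm ((snd s - x0) - coord_proj e {..<m} (snd s - x0)) < \<eta>"
        using proj_tail_small[OF \<eta>] by blast
      obtain u where "u \<in> A" "norm (coord_proj e {..<m} (u - x0)) < \<eta> / real (Suc (Suc n))"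
        using far[of "\<eta> / real (Suc (Suc n))"] \<eta> by auto
      then show "\<exists>t. ?P (Suc n) t \<and> ?Q n s t" using m by (intro exI[of _ "(m, u)"]) simp
    qed
    then show thesis using that by blast
  qed
  define N where "N n = fst (S n)" for n
  define U where "U n = snd (S n) - x0" for n
  have N: "N n < N (Suc n)" for n using S(3) by (simp add: N_def)
  then have N_mono: "N m \<le> N n" if "m \<le> n" for m n
    using that lift_Suc_mono_le[of N] less_imp_le by blast
  \<comment> \<open>For \<open>i \<ge> N 0\<close> this is the index of the block containing \<open>i\<close>; the signs at smaller
    positions are immaterial.\<close>
  define block where "block i = (LEAST n. i < N (Suc n))" for i
  have block: "block i = n" if "N n \<le> i" "i < N (Suc n)" for i n
    unfolding block_def
  proof (rule Least_equality)
    fix m assume "i < N (Suc m)"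
    then show "n \<le> m" using that(1) N_mono[of "Suc m" n] by (meson leD leI le_trans not_less_eq_eq)
  qed (rule that(2))
  define s where "s i = (if basis_coeff e (U (block i)) i < 0 then - 1 else 1 :: real)" for i
  define g where "g x = (\<Sum>i. s i * basis_coeff e x i)" for x
  have s: "\<bar>s i\<bar> \<le> 1" for i by (simp add: s_def)
  have g_linear: "bounded_linear g"
    unfolding g_def[abs_def] by (rule signed_sum_functional(1)[OF r low s])
  have g_bound: "\<bar>g x\<bar> \<le> norm x * K" for x
    unfolding g_def K_def by (rule signed_sum_functional(2)[OF r low s])
  have g_proj: "g (coord_proj e F x) = (\<Sum>i\<in>F. s i * basis_coeff e x i)" if "finite F" for F x
    unfolding g_def by (rule signed_sum_functional(3)[OF r low s that])
  have gU: "\<kappa> \<le> g (U n)" for n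
  proof -
    let ?B = "{N n..<N (Suc n)}"
    let ?V = "coord_proj e ?B (U n)"
    have "{..<N (Suc n)} = {..<N n} \<union> ?B" using N[of n] by auto
    then have "coord_proj e {..<N (Suc n)} (U n) = coord_proj e {..<N n} (U n) + ?V"
      by (simp add: proj_union ivl_disj_int)
    then have eq: "U n - ?V = (U n - coord_proj e {..<N (Suc n)} (U n)) + coord_proj e {..<N n} (U n)" by simp
    have "norm (U n - coord_proj e {..<N (Suc n)} (U n)) \<le> \<eta>"
      using S(4)[of n] by (simp add: U_def N_def)
    moreover have "norm (coord_proj e {..<N n} (U n)) \<le> \<eta>"
    proof -
      have "\<eta> / real (Suc n) \<le> \<eta>" using \<eta> by (simp add: field_simps)
      then show ?thesis using S(2)[of n] unfolding U_def N_def by linarith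
    qed
    ultimately have rest: "norm (U n - ?V) \<le> 2 * \<eta>"
      unfolding eq
      using norm_triangle_ineq[of "U n - coord_proj e {..<N (Suc n)} (U n)" "coord_proj e {..<N n} (U n)"] by linarith
    have "g ?V = (\<Sum>i\<in>?B. s i * basis_coeff e (U n) i)" by (rule g_proj) simp
    also have "\<dots> = (\<Sum>i\<in>?B. \<bar>basis_coeff e (U n) i\<bar>)"
      by (rule sum.cong) (auto simp: s_def block)
    finally have gV: "g ?V = (\<Sum>i\<in>?B. \<bar>basis_coeff e (U n) i\<bar>)" .
    have "norm ?V \<le> (\<Sum>i\<in>?B. \<bar>basis_coeff e (U n) i\<bar> * E)"
      unfolding coord_proj_def by (rule sum_norm_le) (use E in \<open>simp add: mult_left_mono\<close>)
    then have "norm ?V \<le> g ?V * E" by (simp add: gV sum_distrib_right)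
    moreover have "\<tau> / 4 \<le> norm ?V + norm (U n - ?V)"
      using A[OF S(1)[of n]] norm_triangle_ineq[of ?V "U n - ?V"] by (simp add: U_def)
    ultimately have "\<tau> / 4 - 2 * \<eta> \<le> g ?V * E" using rest by linarith
    then have "2 * \<kappa> - 2 * \<eta> / E \<le> g ?V" using E0 by (simp add: \<kappa>_def field_simps)
    moreover have "\<bar>g (U n - ?V)\<bar> \<le> 2 * \<eta> * K"
    proof -
      have "norm (U n - ?V) * K \<le> 2 * \<eta> * K" using rest K by (intro mult_right_mono) auto
      then show ?thesis using g_bound[of "U n - ?V"] by linarith
    qed
    moreover have "g (U n - ?V) = g (U n) - g ?V" using g_linear by (rule linear_simps(2))
    ultimately show ?thesis using \<eta>\<kappa> by linarith
  qed
  define c where "c n = (1 + D) / 2 * (\<eta> / real (Suc n))" for n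
  \<comment> \<open>These closed convex sets contain all later approximate fixed points, so they have a common
    point in \<open>C\<close>, and only \<open>x0\<close> survives the shrinking bounds on the projections.\<close>
  define H where "H n = g -` {\<kappa> + g x0..} \<inter> coord_proj e {..<N n} -` cball (coord_proj e {..<N n} x0) (c n)" for n
  have H_iff: "x \<in> H n \<longleftrightarrow> \<kappa> \<le> g (x - x0) \<and> norm (coord_proj e {..<N n} (x - x0)) \<le> c n" for x n
    using linear_simps(2)[OF g_linear, of x x0]
    by (auto simp: H_def proj_diff dist_norm norm_minus_commute)
  have bp: "bounded_linear (coord_proj e {..<n})" for n by (rule bounded_linear_proj) simp
  have "C \<inter> \<Inter>(range H) \<noteq> {}"
  proof (rule weakly_compact_inter_nonempty[OF C(1)])
    show "closed B \<and> convex B" if "B \<in> range H" for B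
    proof -
      have "closed (H n)" for n
        unfolding H_def
        by (intro closed_Int closed_vimage_bounded_linear[OF g_linear] closed_vimage_bounded_linear[OF bp])
          simp_all
      moreover have "convex (H n)" for n
        unfolding H_def
        by (intro convex_Int convex_linear_vimage bounded_linear.linear g_linear bp) simp_all
      ultimately show ?thesis using that by blast
    qed
    fix \<F> assume "finite \<F>" "\<F> \<subseteq> range H"
    then have "\<exists>I\<subseteq>UNIV. finite I \<and> \<F> = H ` I" by (rule finite_subset_image)
    then obtain I where I: "finite I" "\<F> = H ` I" by blast
    obtain m where m: "\<And>i. i \<in> I \<Longrightarrow> i \<le> m"
      using I(1) unfolding finite_nat_set_iff_bounded_le by blast
    have "snd (S m) \<in> H i" if "i \<in> I" for i
    proof -
      have "{..<N i} \<inter> {..<N m} = {..<N i}" using N_mono[OF m[OF that]] by auto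
      then have "norm (coord_proj e {..<N i} (U m)) \<le> (1 + D) / 2 * norm (coord_proj e {..<N m} (U m))"
        using norm_proj_le[of "{..<N i}" "coord_proj e {..<N m} (U m)"] by (simp add: proj_proj)
      also have "\<dots> \<le> c i" unfolding c_def
      proof (rule mult_left_mono)
        have "\<eta> / real (Suc m) \<le> \<eta> / real (Suc i)" using m[OF that] \<eta> by (simp add: frac_le)
        then show "norm (coord_proj e {..<N m} (U m)) \<le> \<eta> / real (Suc i)"
          using S(2)[of m] unfolding U_def N_def by linarith
      qed (use D_ge_1 in simp)
      finally show ?thesis using gU[of m] unfolding H_iff U_def by blast
    qed
    then have "snd (S m) \<in> C \<inter> \<Inter>\<F>" using S(1)[of m] I(2) by (auto simp: A_def)
    then show "C \<inter> \<Inter>\<F> \<noteq> {}" by blast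
  qed
  then obtain x where "\<And>n. x \<in> H n" by blast
  then have x: "\<kappa> \<le> g (x - x0)" "\<And>n. norm (coord_proj e {..<N n} (x - x0)) \<le> c n"
    unfolding H_iff by blast+
  have "strict_mono N" using N by (rule strict_mono_Suc_iff[THEN iffD2, rule_format])
  then have "(\<lambda>n. coord_proj e {..<N n} (x - x0)) \<longlonglongrightarrow> x - x0"
    using LIMSEQ_subseq_LIMSEQ[OF proj_lessThan_tendsto] by (simp add: o_def)
  moreover have "(\<lambda>n. coord_proj e {..<N n} (x - x0)) \<longlonglongrightarrow> 0"
  proof (rule Lim_null_comparison)
    show "\<forall>\<^sub>F n in sequentially. norm (coord_proj e {..<N n} (x - x0)) \<le> c n" using x(2) by simp
    have "(\<lambda>n. (1 + D) / 2 * \<eta> * inverse (real (Suc n))) \<longlonglongrightarrow> (1 + D) / 2 * \<eta> * 0"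
      by (intro tendsto_mult_left LIMSEQ_inverse_real_of_nat)
    then show "c \<longlonglongrightarrow> 0" by (simp add: c_def[abs_def] field_simps)
  qed
  ultimately have "x - x0 = 0" by (rule LIMSEQ_unique)
  then have "g (x - x0) = 0" using linear_simps(3)[OF g_linear] by simp
  then show False using x(1) \<kappa> by simp
qed

section \<open>The weak fixed point property\<close>

theorem theorem4:
  fixes e :: "nat \<Rightarrow> 'a::banach" and D :: real
  assumes "D_unconditional_basis D e"
    and "spreading e"
    and "D < sqrt 6 - 1"
  shows "weak_fixed_point_property TYPE('a)"
  unfolding weak_fixed_point_property_def
proof (intro allI impI, elim conjE)
  fix C :: "'a set" and T :: "'a \<Rightarrow> 'a"
  assume C: "C \<noteq> {}" "compactin weak_topology C" "convex C"
    and T: "T \<in> C \<rightarrow> C" "1-lipschitz_on C T"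
  interpret D_basis e D by unfold_locales (rule assms(1))
  have "sqrt 6 < 3" by (rule real_less_lsqrt) simp_all
  then have D: "D < 2" using assms(3) by linarith
  show "\<exists>x\<in>C. T x = x"
  proof (cases "\<forall>r>0. \<exists>N>0. norm (\<Sum>l<N. e l) \<le> r * real N")
    case True
    then have "norm (\<Sum>i\<in>{..<k} - G. a i *\<^sub>R e i) \<le> norm (\<Sum>i<k. a i *\<^sub>R e i)"
      if "G \<subseteq> {..<k}" for k G a
      using spreading_suppression[OF assms(2) _ that] by blast
    note contr = suppression_norm_le[OF this]
    show ?thesis
      by (rule fixed_point_if_projections_contract[OF contr D C(2,3,1) T])
  next
    case False
    then obtain r where r: "r > 0" and "\<And>N. N > 0 \<Longrightarrow> r * real N < norm (\<Sum>l<N. e l)"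
      by (meson not_le)
    then have "r * real N \<le> norm (\<Sum>l<N. e l)" for N by (cases "N = 0") (auto intro: less_imp_le)
    note low = spreading_sum_functional[OF assms(2) this]
    show ?thesis
      by (rule fixed_point_if_sum_bounded[OF r low eq_refl[OF spreading_norm_eq[OF assms(2)]]
            C(2,3,1) T])
  qed
qed

end
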